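(* For every continuous path $f:[0,1]\to\mathbb{H}$ with $f(0)=\mathbf 0$ there is a unique continuous lift $\widehat f:[0,1]\to\widehat{\mathbb{H}}$ with $\widehat f(0)=\mathbf 1$ such that $q\circ\widehat f=f$.
   Context: **Hawaiian Earring.** $\mathbb{H}=\bigcup_{i\in\mathbb N}C_i\subseteq\mathbb R^2$ with $C_i=\{(x,y)\in\mathbb{R}^2: x^2+(y-1/i)^2=1/i^2\}$, $i=1,2,3,\dots$, with the subspace topology and base point $\mathbf 0=(0,0)$. Let $l_i:[0,1]\to C_i$, $l_i(t)=((\sin 2\pi t)/i,(1-\cos 2\pi t)/i)$. **Words and Cayley tree.** Let $\mathcal W_n$ be the set of finite words over $\{a_1^{\pm1},\dots,a_n^{\pm1}\}$ and $\mathcal W=\bigcup_n\mathcal W_n$. For $w\in\mathcal W$, $w'$ is its complete free reduction and $|w|$ its length; $\mathbf 1$ denotes the empty word. Let $\Gamma$ be the directed Cayley graph of the free group on $\{a_1,a_2,\dots\}$: the vertex set $V$ is the set of reduced words, and there is a directed edge labeled $a_i$ from $u$ to $(ua_i)'$ for every $u\in V$, $i\in\mathbb N$. The underlying undirected graph is a tree. Fix a complete list $w_1,w_2,w_3,\dots$ of all non-empty words in $\mathcal W$. For each $j$ let $\widehat w_j=a_1a_2a_1a_2\cdots\in V$ be the word with letters alternating between $a_1$ and $a_2$ (starting with $a_1$) of length $|\widehat w_j|=2(|w_1|+\cdots+|w_{j-1}|)+3j+|w_j|$. **The graph $\widehat{\mathbb H}$.** Step 1: If $w_j=x_1x_2\cdots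 x_m$ with letters $x_i$, let $Z_j=\{(\widehat w_jx_1\cdots x_i)': 0\le i\le m\}$. Let $Z$ be the set of vertices of the infinite ray in $\Gamma$ starting at $\mathbf 1$ and following the edges $a_1,a_2,a_1,a_2,\dots$. Step 2: Let $n=n(j)\ge2$ be minimal with $w_j\in\mathcal W_n$. For $u\in Z_j$ and $1\le s\le n$ let $L_{u,s}=\{(ua_s^r)': r\in\mathbb Z\}$. Let $Y_j=Z_j\cup\bigcup_{u\in Z_j,\,1\le s\le n}L_{u,s}$ and $Y=Z\cup\bigcup_jY_j$. (The sets $Y_j$ are pairwise disjoint.) Step 3: Let $\Gamma_0=\Gamma$. Inductively, $\Gamma_j$ is obtained from $\Gamma_{j-1}$ by removing all vertices $v$ at edge-distance $1$ from $Y_j$, unless $v$ is connected to $Y_j$ by an edge labeled $a_1$ or $a_2$ (in either direction), along with all edges incident to $v$ and all vertices and edges of $\Gamma_{j-1}$ separated from $Y_j$ in $\Gamma_{j-1}$ by $v$. Each $\Gamma_j$ is a subtree containing $Y$. Step 4: $\Gamma^*$ is obtained from $\bigcap_j\Gamma_j$ by removing all vertices $v$ (and incident edges) of the reduced form $v=ua_k^{\pm1}w$, where $u$ is a vertex of $\bigcap_j\Gamma_j$ of infinite valence, $k\notin\{1,2\}$ and $w\in\mathcal W$. For every vertex $v$ of the tree $\Gamma^*$ there is a finite set $E_v\subseteq\mathbb N$ such that the directed edges of $\Gamma^*$ terminating at $v$ are labeled exactly by $\{a_i:i\in E_v\}$ (one each), and likewise for the directed edges emanating from $v$. Step 5: For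 every vertex $v$ of $\Gamma^*$ and every $i\in\mathbb N\setminus E_v$ add a directed loop from $v$ to $v$ labeled $a_i$. The geometric realization of the resulting graph is $\widehat{\mathbb H}$, with base point the vertex $\mathbf 1$. **The map $q$ and the topology of $\widehat{\mathbb H}$.** In $\mathbb H$ put $V_i^-=l_i([0,3/8))$, $V_i^+=l_i((5/8,1])$, $U_i=l_i((1/4,3/4))$ and $U_{n+1}^\infty=\bigcup_{i=1}^n(V_i^-\cup V_i^+)\cup\bigcup_{i\ge n+1}C_i$. For a directed edge (or loop) $e$ of $\widehat{\mathbb H}$ labeled $a_i$ with parametrization $\psi_e:[0,1]\to e$, put $V_e^-=\psi_e([0,3/8))$, $V_e^+=\psi_e((5/8,1])$, $U_e=\psi_e((1/4,3/4))$. The map $q:\widehat{\mathbb H}\to\mathbb H$ is given by $q(\psi_e(t))=l_i(t)$ for every edge or loop $e$ labeled $a_i$ (so vertices map to $\mathbf 0$). For a vertex $v$, with $n\ge2$ minimal such that $E_v\subseteq\{1,\dots,n\}$, let $U_v$ be the union of all $V_e^-$ with $e$ an edge or loop emanating from $v$, all $V_e^+$ with $e$ an edge or loop terminating at $v$, and all entire loops at $v$ labeled $a_i$ with $i>n$; $q$ restricts to bijections $U_e\to U_i$ and $U_v\to U_{n+1}^\infty$. $\widehat{\mathbb H}$ carries the unique topology making all $U_e$ and $U_v$ open and all the restrictions $q|_{U_e}:U_e\to U_i$ and $q|_{U_v}:U_v\to U_{n+1}^\infty$ homeomorphisms. *)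

theory Defs
  imports "HOL-Analysis.Analysis"
begin

section \<open>The Hawaiian Earring\<close>

text \<open>All indices \<open>i\<close>, \<open>j\<close>, \<open>n\<close> start at 1.\<close>

definition circle :: "nat \<Rightarrow> (real \<times> real) set" where
  "circle i = {(x, y). x\<^sup>2 + (y - 1 / real i)\<^sup>2 = 1 / (real i)\<^sup>2}"

definition hawaiian :: "(real \<times> real) set" where
  "hawaiian = (\<Union>i\<in>{1..}. circle i)"

definition circle_param :: "nat \<Rightarrow> real \<Rightarrow> real \<times> real" where
  "circle_param i t = (sin (2 * pi * t) / real i, (1 - cos (2 * pi * t)) / real i)"

definition U_arc :: "nat \<Rightarrow> (real \<times> real) set" where
  "U_arc i = circle_param i ` {1/4<..<3/4}"

definition U_inf :: "nat \<Rightarrow> (real \<times> real) set" where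
  "U_inf m = (\<Union>i\<in>{1..<m}. circle_param i ` {0..<3/8} \<union> circle_param i ` {5/8<..1})
             \<union> (\<Union>i\<in>{m..}. circle i)"

section \<open>Words and the Cayley tree\<close>

text \<open>The letter \<open>(i, True)\<close> stands for \<open>a\<^sub>i\<close>, and \<open>(i, False)\<close> for its inverse.\<close>

type_synonym letter = "nat \<times> bool"
type_synonym word = "letter list"

definition words_upto :: "nat \<Rightarrow> word set" where
  "words_upto n = {w. \<forall>x\<in>set w. 1 \<le> fst x \<and> fst x \<le> n}"

definition words :: "word set" where
  "words = (\<Union>n. words_upto n)"

definition inv_letter :: "letter \<Rightarrow> letter" where
  "inv_letter x = (fst x, \<not> snd x)"

definition reduced :: "word \<Rightarrow> bool" where
  "reduced w \<longleftrightarrow> successively (\<lambda>x y. y \<noteq> inv_letter x) w"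

fun cons_reduce :: "letter \<Rightarrow> word \<Rightarrow> word" where
  "cons_reduce x [] = [x]"
| "cons_reduce x (y # ys) = (if y = inv_letter x then ys else x # y # ys)"

definition reduce :: "word \<Rightarrow> word" where
  "reduce w = foldr cons_reduce w []"

text \<open>The next three facts characterize \<open>reduce\<close> as complete free reduction.\<close>

lemma reduced_cons_reduce: "reduced w \<Longrightarrow> reduced (cons_reduce x w)"
  by (cases w) (auto simp: reduced_def successively_Cons)

lemma reduced_reduce: "reduced (reduce w)"
  by (induction w) (simp_all add: reduce_def reduced_cons_reduce, simp add: reduced_def)

lemma reduce_reduced: "reduced w \<Longrightarrow> reduce w = w"
proof (induction w)
  case (Cons x w)
  then show ?case
    by (cases w) (auto simp: reduce_def reduced_def)
qed (simp add: reduce_def)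

lemma reduce_cancel: "reduce (u @ [x, inv_letter x] @ v) = reduce (u @ v)"
proof -
  have "cons_reduce x (cons_reduce (inv_letter x) w) = w" if "reduced w" for w
    using that
    by (cases w; cases "tl w") (auto simp: reduced_def inv_letter_def prod_eq_iff)
  from this[OF reduced_reduce[of v]] show ?thesis
    by (simp add: reduce_def)
qed

definition vertices :: "word set" where
  "vertices = {w \<in> words. reduced w}"

text \<open>The directed edges are \<open>u \<rightarrow> arrow u i\<close>, with label \<open>a\<^sub>i\<close>.\<close>

definition arrow :: "word \<Rightarrow> nat \<Rightarrow> word" where
  "arrow u i = reduce (u @ [(i, True)])"

text \<open>
  All the subgraphs of the Cayley tree below arise by deleting vertices together with their
  incident edges (an edge separated from a set by a vertex \<open>v\<close> is incident to \<open>v\<close> or to a vertex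
  separated by \<open>v\<close>).  They are therefore full subgraphs, and are represented by their
  vertex sets \<open>A\<close>.
\<close>

definition joined :: "nat \<Rightarrow> word \<Rightarrow> word \<Rightarrow> bool" where
  "joined i u v \<longleftrightarrow> v = arrow u i \<or> u = arrow v i"

definition adj :: "word set \<Rightarrow> (word \<times> word) set" where
  "adj A = {(u, v). u \<in> A \<and> v \<in> A \<and> (\<exists>i\<ge>1. joined i u v)}"

definition separated :: "word set \<Rightarrow> word set \<Rightarrow> word \<Rightarrow> word \<Rightarrow> bool" where
  "separated A Y v x \<longleftrightarrow> x \<in> A - {v} \<and> \<not> (\<exists>y\<in>Y. (x, y) \<in> (adj (A - {v}))\<^sup>*)"

section \<open>The tree underlying the graph\<close>

text \<open>The parameter \<open>w\<close> is the fixed list \<open>w 1, w 2, \<dots>\<close> of all non-empty words; \<open>w 0\<close> is never used.\<close>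

definition alternating :: "nat \<Rightarrow> word" where
  "alternating m = map (\<lambda>k. (if even k then 1 else 2, True)) [0..<m]"

definition w_hat :: "(nat \<Rightarrow> word) \<Rightarrow> nat \<Rightarrow> word" where
  "w_hat w j = alternating (2 * (\<Sum>k\<in>{1..<j}. length (w k)) + 3 * j + length (w j))"

definition Z_set :: "(nat \<Rightarrow> word) \<Rightarrow> nat \<Rightarrow> word set" where
  "Z_set w j = {reduce (w_hat w j @ take i (w j)) |i. i \<le> length (w j)}"

definition n_of :: "(nat \<Rightarrow> word) \<Rightarrow> nat \<Rightarrow> nat" where
  "n_of w j = (LEAST n. 2 \<le> n \<and> w j \<in> words_upto n)"

definition letter_power :: "nat \<Rightarrow> int \<Rightarrow> word" where
  "letter_power s r = replicate (nat \<bar>r\<bar>) (s, r \<ge> 0)"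

definition L_line :: "word \<Rightarrow> nat \<Rightarrow> word set" where
  "L_line u s = {reduce (u @ letter_power s r) |r. True}"

definition Y_set :: "(nat \<Rightarrow> word) \<Rightarrow> nat \<Rightarrow> word set" where
  "Y_set w j = Z_set w j \<union> (\<Union>u\<in>Z_set w j. \<Union>s\<in>{1..n_of w j}. L_line u s)"

text \<open>A vertex has edge-distance 1 from \<open>Y\<close> iff it lies outside \<open>Y\<close> and is adjacent to an element
  of \<open>Y\<close>.\<close>

definition cut_vertices :: "word set \<Rightarrow> word set \<Rightarrow> word set" where
  "cut_vertices A Y =
     {v \<in> A - Y. (\<exists>y\<in>Y. (y, v) \<in> adj A) \<and>
                 \<not> (\<exists>y\<in>Y. (y, v) \<in> adj A \<and> (joined 1 y v \<or> joined 2 y v))}"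

definition prune :: "word set \<Rightarrow> word set \<Rightarrow> word set" where
  "prune A Y = A - cut_vertices A Y - {x. \<exists>v\<in>cut_vertices A Y. separated A Y v x}"

primrec tree_stage :: "(nat \<Rightarrow> word) \<Rightarrow> nat \<Rightarrow> word set" where
  "tree_stage w 0 = vertices"
| "tree_stage w (Suc j) = prune (tree_stage w j) (Y_set w (Suc j))"

definition tree_inf :: "(nat \<Rightarrow> word) \<Rightarrow> word set" where
  "tree_inf w = (\<Inter>j. tree_stage w j)"

definition tree_star :: "(nat \<Rightarrow> word) \<Rightarrow> word set" where
  "tree_star w = tree_inf w -
     {v. \<exists>u k b x. v = u @ [(k, b)] @ x \<and> u \<in> tree_inf w \<and> infinite (adj (tree_inf w) `` {u})
                   \<and> k \<notin> {1, 2}}"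

section \<open>The graph and its topology\<close>

definition E_labels :: "(nat \<Rightarrow> word) \<Rightarrow> word \<Rightarrow> nat set" where
  "E_labels w v = {i. 1 \<le> i \<and> (\<exists>u\<in>tree_star w. arrow u i = v)}"

text \<open>An edge is a triple consisting of its source, the index of its label, and its target.\<close>

type_synonym edge = "word \<times> nat \<times> word"

definition src :: "edge \<Rightarrow> word" where "src e = fst e"
definition lab :: "edge \<Rightarrow> nat" where "lab e = fst (snd e)"
definition tgt :: "edge \<Rightarrow> word" where "tgt e = snd (snd e)"

definition edges :: "(nat \<Rightarrow> word) \<Rightarrow> edge set" where
  "edges w = {(u, i, arrow u i) |u i. 1 \<le> i \<and> u \<in> tree_star w \<and> arrow u i \<in> tree_star w}
           \<union> {(v, i, v) |v i. 1 \<le> i \<and> v \<in> tree_star w \<and> i \<notin> E_labels w v}"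

text \<open>Points of the geometric realization: the vertices, and the points \<open>Inner e t\<close> with
  \<open>0 < t < 1\<close> in the interior of an edge or loop \<open>e\<close>.\<close>

datatype point = Vertex word | Inner edge real

definition edge_param :: "edge \<Rightarrow> real \<Rightarrow> point" where
  "edge_param e t = (if t = 0 then Vertex (src e) else if t = 1 then Vertex (tgt e) else Inner e t)"

definition H_hat :: "(nat \<Rightarrow> word) \<Rightarrow> point set" where
  "H_hat w = Vertex ` tree_star w \<union> (\<Union>e\<in>edges w. edge_param e ` {0..1})"

text \<open>On \<open>H_hat w\<close> this is the map with \<open>q_map (edge_param e t) = circle_param (lab e) t\<close>.\<close>

fun q_map :: "point \<Rightarrow> real \<times> real" where
  "q_map (Vertex v) = (0, 0)"
| "q_map (Inner e t) = circle_param (lab e) t"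

lemma q_map_edge_param: "q_map (edge_param e t) = circle_param (lab e) t"
  by (simp add: edge_param_def circle_param_def)

definition U_edge :: "edge \<Rightarrow> point set" where
  "U_edge e = edge_param e ` {1/4<..<3/4}"

definition n_vertex :: "(nat \<Rightarrow> word) \<Rightarrow> word \<Rightarrow> nat" where
  "n_vertex w v = (LEAST n. 2 \<le> n \<and> E_labels w v \<subseteq> {1..n})"

definition U_vertex :: "(nat \<Rightarrow> word) \<Rightarrow> word \<Rightarrow> point set" where
  "U_vertex w v =
     (\<Union>e\<in>{e \<in> edges w. src e = v}. edge_param e ` {0..<3/8})
   \<union> (\<Union>e\<in>{e \<in> edges w. tgt e = v}. edge_param e ` {5/8<..1})
   \<union> (\<Union>e\<in>{e \<in> edges w. src e = v \<and> tgt e = v \<and> n_vertex w v < lab e}. edge_param e ` {0..1})"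

definition H_hat_topology :: "(nat \<Rightarrow> word) \<Rightarrow> point topology" where
  "H_hat_topology w = (THE T. topspace T = H_hat w \<and>
     (\<forall>e\<in>edges w. openin T (U_edge e) \<and>
        homeomorphic_map (subtopology T (U_edge e)) (top_of_set (U_arc (lab e))) q_map) \<and>
     (\<forall>v\<in>tree_star w. openin T (U_vertex w v) \<and>
        homeomorphic_map (subtopology T (U_vertex w v))
          (top_of_set (U_inf (n_vertex w v + 1))) q_map))"

end

theory Submission
  imports Defs "HOL-Library.Sublist"
begin

text \<open>
  The map \<open>q\<close> is a local homeomorphism with separated fibres, but not a covering, since the size of
  an evenly covered neighbourhood of the base point depends on the vertex above it.  Uniqueness of
  lifts is immediate; a lift can be continued as long as it stays inside one chart when it approaches
  the end of its domain.  The danger is a lift that wanders through infinitely many vertices along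
  edges with labels tending to infinity.  It is excluded by the shape of \<open>\<Gamma>\<^sup>*\<close>: an edge of \<open>\<Gamma>\<^sup>*\<close>
  with label at least 3 starts in some \<open>Y\<^sub>j\<close>, has both ends in the same sets \<open>Y\<^sub>j\<close>, and the labels in
  \<open>Y\<^sub>j\<close> are bounded.
\<close>


section \<open>The Cayley tree\<close>

text \<open>The tree is treated as rooted at the empty word: a vertex lies beyond each of its
  prefixes. In this view Y_j is entered from the root side only along letters of an alternating
  word, so an edge with a label above 2 never enters it, and the pruning removes the edges with such
  labels that leave it. This is why the two ends of a surviving edge lie in the same Y_j, and why
  the whole construction of the tree collapses to one condition on the prefixes of a word
  (\<open>tree_star_iff\<close>). Attaching the loops requires in addition that the same labels
  enter and leave each vertex. This rests on Y_j being a union of entire lines through the connected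
  set Z_j. For the lifting, the obstacle is that no single neighbourhood of the base point serves
  all vertices. The lift is therefore confined in two rounds: avoiding the middle arcs of the first
  two circles fixes a set of vertices with bounded labels, and only this bound tells how far the
  path must be followed to confine the lift to one vertex.\<close>

lemma inv_letter_inv [simp]: "inv_letter (inv_letter x) = x"
  by (simp add: inv_letter_def)

lemma fst_inv_letter [simp]: "fst (inv_letter x) = fst x"
  by (simp add: inv_letter_def)

lemma reduce_append_reduce: "reduce (reduce u @ v) = reduce (u @ v)"
proof (induction u)
  case (Cons x u)
  \<comment> \<open>Only the case where \<open>x\<close> cancels the head of \<open>y\<close> is not
    immediate; there \<open>reduce_cancel\<close> with an empty left part applies.\<close>
  have "reduce (cons_reduce x y @ v) = cons_reduce x (reduce (y @ v))" for y
    using reduce_cancel[of "[]" x "tl y @ v"]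
    by (cases "(x, y)" rule: cons_reduce.cases) (auto simp: reduce_def)
  with Cons show ?case
    by (simp add: reduce_def)
qed (simp add: reduce_def)

text \<open>Right multiplication by a letter, that is, one move along an edge in either direction.
  Unlike \<open>reduce\<close>, it touches only the end of the word: a move away from the root
  appends a letter, a move towards the root drops one.\<close>

definition step :: "word \<Rightarrow> letter \<Rightarrow> word" where
  "step u x = (if u \<noteq> [] \<and> last u = inv_letter x then butlast u else u @ [x])"

lemma step_cases:
  obtains v where "u = v @ [inv_letter x]" "step u x = v"
  | "step u x = u @ [x]" "u = [] \<or> last u \<noteq> inv_letter x"
proof (cases "u \<noteq> [] \<and> last u = inv_letter x")
  case True
  then have "u = butlast u @ [inv_letter x]"
    by (metis append_butlast_last_id)
  with True show ?thesis
    by (intro that(1)[of "butlast u"]) (auto simp: step_def)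
qed (use that(2) in \<open>auto simp: step_def\<close>)

lemma reduced_append1:
  "reduced (u @ [x]) \<longleftrightarrow> reduced u \<and> (u = [] \<or> last u \<noteq> inv_letter x)"
  by (auto simp: reduced_def successively_append_iff inv_letter_def prod_eq_iff)

lemma reduced_prefix: "reduced v \<Longrightarrow> prefix u v \<Longrightarrow> reduced u"
  by (auto simp: prefix_def reduced_def successively_append_iff)

lemma reduced_step: "reduced u \<Longrightarrow> reduced (step u x)"
  by (cases u x rule: step_cases) (auto simp: reduced_append1)

lemma reduce_snoc: "reduce (u @ [x]) = step (reduce u) x"
proof -
  have "reduce (v @ [x]) = step v x" if "reduced v" for v
    using that reduce_cancel[of _ "inv_letter x" "[]"]
    by (cases v x rule: step_cases) (auto simp: reduced_append1 reduce_reduced)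
  from this[OF reduced_reduce] show ?thesis
    by (simp add: reduce_append_reduce)
qed

lemma arrow_eq_step: "reduced u \<Longrightarrow> arrow u i = step u (i, True)"
  by (simp add: arrow_def reduce_snoc reduce_reduced)

lemma step_inv_letter [simp]: "reduced u \<Longrightarrow> step (step u x) (inv_letter x) = u"
  by (cases u x rule: step_cases; cases "step u x" "inv_letter x" rule: step_cases)
     (auto simp: reduced_append1)

lemma step_Not [simp]: "reduced u \<Longrightarrow> step (step u (k, b)) (k, \<not> b) = u"
  using step_inv_letter[of u "(k, b)"] by (simp add: inv_letter_def)

lemma step_neq [simp]: "step u x \<noteq> u" "u \<noteq> step u x"
  by (cases u x rule: step_cases; auto)+

lemma joined_iff: "reduced u \<Longrightarrow> reduced v \<Longrightarrow> joined i u v \<longleftrightarrow> (\<exists>b. v = step u (i, b))"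
  unfolding joined_def by (metis (full_types) arrow_eq_step step_Not)

lemma verticesD: "u \<in> vertices \<Longrightarrow> reduced u" "u \<in> vertices \<Longrightarrow> u \<in> words"
  by (auto simp: vertices_def)

lemma adj_iff:
  assumes "A \<subseteq> vertices"
  shows "(u, v) \<in> adj A \<longleftrightarrow> u \<in> A \<and> v \<in> A \<and> (\<exists>x. 1 \<le> fst x \<and> v = step u x)"
  using assms joined_iff[of u v] by (fastforce simp: adj_def dest: verticesD)

lemma words_iff: "u \<in> words \<longleftrightarrow> (\<forall>x\<in>set u. 1 \<le> fst x)"
proof
  assume *: "\<forall>x\<in>set u. 1 \<le> fst x"
  have "u \<in> words_upto (Max (fst ` set u))"
    using * by (auto simp: words_upto_def)
  then show "u \<in> words"
    by (auto simp: words_def)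
qed (auto simp: words_def words_upto_def)

lemma vertices_prefix: "v \<in> vertices \<Longrightarrow> prefix u v \<Longrightarrow> u \<in> vertices"
  unfolding vertices_def words_iff using reduced_prefix set_mono_prefix by blast

lemma step_in_vertices: "u \<in> vertices \<Longrightarrow> 1 \<le> fst x \<Longrightarrow> step u x \<in> vertices"
  unfolding vertices_def
  by (cases u x rule: step_cases) (auto simp: words_iff reduced_append1)

text \<open>The words with prefix \<open>e\<close> form one of the two components of the tree without the
  edge from \<open>butlast e\<close> to \<open>e\<close>.\<close>

lemma step_crossing:
  assumes "e \<noteq> []" "prefix e u \<noteq> prefix e (step u x)"
  shows "{u, step u x} = {butlast e, e}" "fst x = fst (last e)"
  using assms by (cases u x rule: step_cases; auto)+

text \<open>A variant of \<open>adj\<close> that ignores labels and directions. It suits sets such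
  as Y_j, whose elements are at first known only to be reduced.\<close>

definition steps_in :: "word set \<Rightarrow> (word \<times> word) set" where
  "steps_in B = {(u, v). u \<in> B \<and> v \<in> B \<and> (\<exists>x. v = step u x)}"

lemma steps_in_mono: "A \<subseteq> B \<Longrightarrow> steps_in A \<subseteq> steps_in B"
  by (auto simp: steps_in_def)

lemma steps_in_sym:
  assumes "\<And>u. u \<in> B \<Longrightarrow> reduced u"
  shows "sym (steps_in B)"
proof (rule symI)
  fix u v assume "(u, v) \<in> steps_in B"
  then obtain x where "u \<in> B" "v \<in> B" "v = step u x"
    by (auto simp: steps_in_def)
  moreover from this have "u = step v (inv_letter x)"
    using assms by simp
  ultimately show "(v, u) \<in> steps_in B"
    unfolding steps_in_def by blast
qed

text \<open>The edge between \<open>butlast e\<close> and \<open>e\<close> is the only bridge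
  between the words with prefix \<open>e\<close> and all others, so a path that changes sides passes
  through both of its ends. All separation and convexity arguments below rest on this.\<close>

lemma steps_in_crossing:
  assumes "(a, b) \<in> (steps_in B)\<^sup>*" "e \<noteq> []" "prefix e a \<noteq> prefix e b"
  shows "e \<in> B" "butlast e \<in> B"
proof -
  have "e \<in> B \<and> butlast e \<in> B"
    using assms
  proof (induction rule: rtrancl_induct)
    case (step u v)
    show ?case
    proof (cases "prefix e a = prefix e u")
      case True
      obtain x where "u \<in> B" "v \<in> B" "v = step u x"
        using step.hyps(2) by (auto simp: steps_in_def)
      then have "{u, v} = {butlast e, e}"
        using step_crossing(1)[of e u x] step.prems True by blast
      with \<open>u \<in> B\<close> \<open>v \<in> B\<close> show ?thesis
        by (auto simp: doubleton_eq_iff)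
    qed (use step in auto)
  qed simp
  then show "e \<in> B" "butlast e \<in> B" by auto
qed

section \<open>The subtrees \<open>Y\<^sub>j\<close>\<close>

lemma alternating_letters: "z \<in> set (alternating m) \<Longrightarrow> fst z \<in> {1, 2}"
  by (auto simp: alternating_def split: if_splits)

lemma reduced_alternating: "reduced (alternating m)"
  by (auto simp: reduced_def alternating_def successively_conv_nth inv_letter_def)

lemma L_line_alt: "L_line u s = {reduce (u @ replicate m (s, b)) |m b. True}"
proof -
  have "\<exists>r. replicate m (s, b) = letter_power s r" for m b
  proof (cases "b \<or> m = 0")
    case True
    then show ?thesis by (intro exI[of _ "int m"]) (auto simp: letter_power_def)
  next
    case False
    then show ?thesis by (intro exI[of _ "- int m"]) (auto simp: letter_power_def)
  qed
  moreover have "\<exists>m b. letter_power s r = replicate m (s, b)" for r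
    unfolding letter_power_def by blast
  ultimately have "range (letter_power s) = {replicate m (s, b) |m b. True}"
    by blast
  then have "(\<lambda>x. reduce (u @ x)) ` range (letter_power s) = (\<lambda>x. reduce (u @ x)) ` {replicate m (s, b) |m b. True}"
    by simp
  then show ?thesis
    unfolding L_line_def by blast
qed

text \<open>A line is walked from \<open>u\<close> in the direction given by the sign
  \<open>b\<close>, so facts about lines follow by induction on single steps.\<close>

lemma L_line_iterate:
  assumes "reduced u"
  shows "L_line u s = {((\<lambda>v. step v (s, b)) ^^ m) u |m b. True}"
proof -
  have "reduce (u @ replicate m x) = ((\<lambda>v. step v x) ^^ m) u" for m x
  proof (induction m)
    case (Suc m)
    then show ?case
      using reduce_snoc[of "u @ replicate m x" x] by (simp add: replicate_append_same)
  qed (use assms in \<open>simp add: reduce_reduced\<close>)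
  then show ?thesis
    by (simp add: L_line_alt)
qed

lemma reduced_iterate_step: "reduced u \<Longrightarrow> reduced (((\<lambda>v. step v x) ^^ m) u)"
  by (induction m) (auto simp: reduced_step)

lemma L_line_base: "reduced u \<Longrightarrow> u \<in> L_line u s"
  by (auto simp: L_line_iterate intro!: exI[of _ 0])

lemma L_line_reduced: "v \<in> L_line u s \<Longrightarrow> reduced v"
  by (auto simp: L_line_def reduced_reduce)

lemma L_line_step:
  assumes "reduced u" "v \<in> L_line u s"
  shows "step v (s, c) \<in> L_line u s"
proof -
  from assms obtain m b where v: "v = ((\<lambda>v. step v (s, b)) ^^ m) u"
    by (auto simp: L_line_iterate)
  let ?it = "\<lambda>c m. ((\<lambda>v. step v (s, c)) ^^ m) u"
  \<comment> \<open>A further step in the same direction, a first step, or a step that undoes the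
    last one.\<close>
  consider "b = c" | "m = 0" | m' where "m = Suc m'" "b = (\<not> c)"
    by (cases m) auto
  then have "\<exists>m' b'. step v (s, c) = ?it b' m'"
  proof cases
    case 1
    then have "step v (s, c) = ?it c (Suc m)" by (simp add: v)
    then show ?thesis by blast
  next
    case 2
    then have "step v (s, c) = ?it c 1" by (simp add: v)
    then show ?thesis by blast
  next
    case 3
    then have "step v (s, c) = ?it b m'"
      using step_Not[OF reduced_iterate_step[OF assms(1)], where k = s and b = b] by (simp add: v)
    then show ?thesis by blast
  qed
  then show ?thesis
    using assms(1) by (auto simp: L_line_iterate)
qed

text \<open>A line in direction \<open>s\<close> traverses only edges labelled \<open>s\<close>, so
  it stays on one side of any edge with another label.\<close>

lemma L_line_crossing:
  assumes "reduced u" "v \<in> L_line u s" "e \<noteq> []" "fst (last e) \<noteq> s"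
  shows "prefix e u \<longleftrightarrow> prefix e v"
proof -
  obtain m b where v: "v = ((\<lambda>v. step v (s, b)) ^^ m) u"
    using assms(1,2) by (auto simp: L_line_iterate)
  have "prefix e u \<longleftrightarrow> prefix e (((\<lambda>v. step v (s, b)) ^^ m) u)"
    by (induction m) (use assms(3,4) step_crossing(2)[of e _ "(s, b)"] in auto)
  then show ?thesis by (simp add: v)
qed

lemma L_line_connected:
  assumes "reduced u" "v \<in> L_line u s"
  shows "(u, v) \<in> (steps_in (L_line u s))\<^sup>*"
proof -
  obtain m b where v: "v = ((\<lambda>v. step v (s, b)) ^^ m) u"
    using assms by (auto simp: L_line_iterate)
  have *: "((\<lambda>v. step v (s, b)) ^^ m) u \<in> L_line u s" for m
    using assms(1) by (auto simp: L_line_iterate)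
  have "(((\<lambda>v. step v (s, b)) ^^ m) u, ((\<lambda>v. step v (s, b)) ^^ Suc m) u) \<in> steps_in (L_line u s)" for m
    using *[of m] *[of "Suc m"] unfolding steps_in_def by auto
  then have "(u, ((\<lambda>v. step v (s, b)) ^^ m) u) \<in> (steps_in (L_line u s))\<^sup>*"
    by (induction m) (auto intro: rtrancl_into_rtrancl)
  then show ?thesis by (simp add: v)
qed

lemma Z_set_reduced: "v \<in> Z_set w j \<Longrightarrow> reduced v"
  by (auto simp: Z_set_def reduced_reduce)

lemma Z_set_connected:
  assumes "v \<in> Z_set w j"
  shows "(w_hat w j, v) \<in> (steps_in (Z_set w j))\<^sup>*"
proof -
  let ?z = "\<lambda>i. reduce (w_hat w j @ take i (w j))"
  have "i \<le> length (w j) \<Longrightarrow> (w_hat w j, ?z i) \<in> (steps_in (Z_set w j))\<^sup>*" for i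
  proof (induction i)
    case 0
    then show ?case by (simp add: reduce_reduced reduced_alternating w_hat_def)
  next
    case (Suc i)
    have "?z (Suc i) = step (?z i) (w j ! i)"
      using Suc.prems reduce_snoc[of "w_hat w j @ take i (w j)"] by (simp add: take_Suc_conv_app_nth)
    moreover have "?z i \<in> Z_set w j" "?z (Suc i) \<in> Z_set w j"
      using Suc.prems by (auto simp: Z_set_def)
    ultimately have "(?z i, ?z (Suc i)) \<in> steps_in (Z_set w j)"
      unfolding steps_in_def by blast
    with Suc show ?case by auto
  qed
  with assms show ?thesis by (auto simp: Z_set_def)
qed

lemma Y_set_reduced: "v \<in> Y_set w j \<Longrightarrow> reduced v"
  by (auto simp: Y_set_def Z_set_reduced L_line_reduced)

lemma Y_set_cases:
  assumes "v \<in> Y_set w j"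
  obtains u s where "u \<in> Z_set w j" "s \<in> {1..n_of w j}" "v \<in> L_line u s"
    "L_line u s \<subseteq> Y_set w j"
  | "v \<in> Z_set w j"
  using assms unfolding Y_set_def by blast

lemma Y_set_connected:
  assumes "v \<in> Y_set w j"
  shows "(w_hat w j, v) \<in> (steps_in (Y_set w j))\<^sup>*"
proof -
  have *: "(w_hat w j, u) \<in> (steps_in (Y_set w j))\<^sup>*" if "u \<in> Z_set w j" for u
  proof -
    have "Z_set w j \<subseteq> Y_set w j" by (auto simp: Y_set_def)
    from rtrancl_mono[OF steps_in_mono[OF this]] Z_set_connected[OF that] show ?thesis by blast
  qed
  from assms show ?thesis
  proof (cases rule: Y_set_cases)
    case (1 u s)
    from rtrancl_mono[OF steps_in_mono[OF 1(4)]] L_line_connected[OF Z_set_reduced[OF 1(1)] 1(3)]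
    show ?thesis using *[OF 1(1)] by (meson rtrancl_trans subsetD)
  qed (use * in auto)
qed

text \<open>If \<open>v\<close> is a proper extension of \<open>u\<close>, the edge into
  \<open>v\<close> separates \<open>u\<close> from \<open>x\<close>. A path inside the connected set
  Y_j must cross it and hence meets \<open>v\<close>.\<close>

lemma Y_set_convex:
  assumes "u \<in> Y_set w j" "x \<in> Y_set w j" "prefix u v" "prefix v x"
  shows "v \<in> Y_set w j"
proof (cases "u = v")
  case False
  have "sym ((steps_in (Y_set w j))\<^sup>*)"
    by (intro sym_rtrancl steps_in_sym Y_set_reduced)
  then have "(u, x) \<in> (steps_in (Y_set w j))\<^sup>*"
    using assms(1,2) Y_set_connected by (meson rtrancl_trans symD)
  moreover have "prefix v u \<noteq> prefix v x" "v \<noteq> []"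
    using False assms(3,4) by auto
  ultimately show ?thesis
    using steps_in_crossing by blast
qed (use assms in simp)

text \<open>A path in Y_j from \<open>w_hat w j\<close> to \<open>v @ [z]\<close> cannot use the
  edge at \<open>v\<close>. So the start already lies beyond this edge, and \<open>z\<close> is one
  of its alternating letters.\<close>

lemma Y_set_top:
  assumes "v @ [z] \<in> Y_set w j" "v \<notin> Y_set w j"
  shows "fst z \<in> {1, 2}"
proof -
  have "prefix (v @ [z]) (w_hat w j)"
    using steps_in_crossing(2)[OF Y_set_connected[OF assms(1)], of "v @ [z]"] assms(2) by auto
  then have "z \<in> set (w_hat w j)"
    using set_mono_prefix by fastforce
  then show ?thesis
    unfolding w_hat_def by (rule alternating_letters)
qed

text \<open>Otherwise the edge lies on none of the lines in direction \<open>k\<close> through Z_j.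
  Its two ends then lie on lines in other directions, which do not cross it, and so are on the same
  sides as points of Z_j. But Z_j is connected and misses both ends, so it lies on a single
  side.\<close>

lemma Y_set_opposite_step:
  assumes v: "v \<in> Y_set w j" and v': "step v (k, b) \<in> Y_set w j" and k: "k \<in> {1..n_of w j}"
  shows "step v (k, \<not> b) \<in> Y_set w j"
proof (rule ccontr)
  assume "\<not> ?thesis"
  with k have no_line: "v \<notin> L_line u k" if "u \<in> Z_set w j" for u
    using that L_line_step[OF Z_set_reduced[OF that], of v k "\<not> b"] by (auto simp: Y_set_def)
  have red: "reduced v" using v by (rule Y_set_reduced)
  have no_line': "step v (k, b) \<notin> L_line u k" if "u \<in> Z_set w j" for u
    using no_line[OF that] L_line_step[OF Z_set_reduced[OF that], of "step v (k, b)" k "\<not> b"] red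
    by auto
  have "v \<notin> Z_set w j"
    using no_line[of v] red L_line_base by blast
  have "step v (k, b) \<notin> Z_set w j"
    using no_line'[of "step v (k, b)"] red L_line_base reduced_step by blast
  obtain u s where u: "u \<in> Z_set w j" "v \<in> L_line u s"
    using v \<open>v \<notin> Z_set w j\<close> by (cases rule: Y_set_cases) auto
  obtain u' s' where u': "u' \<in> Z_set w j" "step v (k, b) \<in> L_line u' s'"
    using v' \<open>step v (k, b) \<notin> Z_set w j\<close> by (cases rule: Y_set_cases) auto
  \<comment> \<open>The end farther from the root, so that having \<open>e\<close> as a prefix tells
    the two sides of the edge apart.\<close>
  define e where "e = (if length v < length (step v (k, b)) then step v (k, b) else v)"
  have e: "e \<noteq> []" "fst (last e) = k" "prefix e v \<noteq> prefix e (step v (k, b))" "e \<notin> Z_set w j"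
    using \<open>v \<notin> Z_set w j\<close> \<open>step v (k, b) \<notin> Z_set w j\<close>
    by (cases v "(k, b)" rule: step_cases; auto simp: e_def)+
  have s: "s \<noteq> k" "s' \<noteq> k"
    using no_line no_line' u u' by auto
  have "prefix e u = prefix e v"
    using L_line_crossing[OF Z_set_reduced[OF u(1)] u(2) e(1)] e(2) s by auto
  moreover have "prefix e u' = prefix e (step v (k, b))"
    using L_line_crossing[OF Z_set_reduced[OF u'(1)] u'(2) e(1)] e(2) s by auto
  \<comment> \<open>Z_j does not contain \<open>e\<close>, so none of its paths crosses the
    edge.\<close>
  moreover have "prefix e (w_hat w j) = prefix e u" "prefix e (w_hat w j) = prefix e u'"
    using steps_in_crossing(1)[OF Z_set_connected e(1)] u(1) u'(1) e(4) by blast+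
  ultimately show False
    using e(3) by auto
qed


section \<open>The tree \<open>\<Gamma>\<^sup>*\<close>\<close>

declare split_paired_All [simp del] split_paired_Ex [simp del]

lemma step_inject: "step u x = step u y \<longleftrightarrow> x = y"
  by (cases u x rule: step_cases; cases u y rule: step_cases)
     (auto simp: inv_letter_def prod_eq_iff dest!: arg_cong[of _ _ length])

lemma sym_adj: "sym (adj A)"
  by (rule symI) (auto simp: adj_def joined_def)

lemma adj_subset_steps_in: "A \<subseteq> vertices \<Longrightarrow> adj A \<subseteq> steps_in A"
  unfolding steps_in_def using adj_iff by blast

lemma step_append: "u @ [x] \<in> vertices \<Longrightarrow> step u x = u @ [x] \<and> 1 \<le> fst x"
  by (auto simp: vertices_def reduced_append1 words_iff step_def)

text \<open>The prefixes of \<open>x\<close> form the path from the root to \<open>x\<close>; this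
  path must not leave \<open>B\<close> through an edge with a label other than 1 and 2. By
  \<open>prune_eq\<close> this is survival of the pruning at \<open>B\<close>. The current stage
  does not occur in it, which turns the recursion \<open>tree_stage\<close> into a
  conjunction.\<close>

definition no_exit :: "word set \<Rightarrow> word \<Rightarrow> bool" where
  "no_exit B x \<longleftrightarrow>
     (\<forall>u z. prefix (u @ [z]) x \<and> fst z \<notin> {1, 2} \<and> u \<in> B \<longrightarrow> u @ [z] \<in> B)"

lemma no_exit_prefix: "no_exit B v \<Longrightarrow> prefix u v \<Longrightarrow> no_exit B u"
  unfolding no_exit_def using prefix_order.trans by blast

context
  fixes A Y :: "word set"
  assumes A: "A \<subseteq> vertices" "[] \<in> A" and closed: "\<And>u v. v \<in> A \<Longrightarrow> prefix u v \<Longrightarrow> u \<in> A"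
    and convex: "\<And>u v x. u \<in> Y \<Longrightarrow> x \<in> Y \<Longrightarrow> prefix u v \<Longrightarrow> prefix v x \<Longrightarrow> v \<in> Y"
    and top: "\<And>v z. v @ [z] \<in> Y \<Longrightarrow> v \<notin> Y \<Longrightarrow> fst z \<in> {1, 2}"
begin

text \<open>A neighbour of Y on the root side is joined to it by an edge entering Y, which has label
  1 or 2 by \<open>top\<close>. So cut vertices occur only on the far side of Y.\<close>

lemma cut_vertices_eq:
  "cut_vertices A Y = {u @ [z] |u z. u @ [z] \<in> A \<and> u \<in> Y \<and> u @ [z] \<notin> Y \<and> fst z \<notin> {1, 2}}"
proof (intro equalityI subsetI)
  fix v assume v: "v \<in> cut_vertices A Y"
  then obtain y where y: "y \<in> Y" "v \<in> A" "v \<notin> Y" "(y, v) \<in> adj A"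
    unfolding cut_vertices_def by blast
  then obtain x where yx: "y \<in> A" "v = step y x"
    using adj_iff[OF A(1)] by blast
  with y have "joined (fst x) y v"
    using A(1) joined_iff[of y v "fst x"] by (metis prod.collapse subsetD verticesD(1))
  with v y(1,4) have x: "fst x \<notin> {1, 2}"
    by (auto simp: cut_vertices_def)
  from y yx show "v \<in> {u @ [z] |u z. u @ [z] \<in> A \<and> u \<in> Y \<and> u @ [z] \<notin> Y \<and> fst z \<notin> {1, 2}}"
    by (cases y x rule: step_cases) (use x top[of v "inv_letter x"] in auto)
next
  fix v assume "v \<in> {u @ [z] |u z. u @ [z] \<in> A \<and> u \<in> Y \<and> u @ [z] \<notin> Y \<and> fst z \<notin> {1, 2}}"
  then obtain u z where v: "v = u @ [z]" "u @ [z] \<in> A" "u \<in> Y" "u @ [z] \<notin> Y" "fst z \<notin> {1, 2}"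
    by blast
  have "u \<in> A" using closed[OF v(2), of u] by simp
  then have "(u, v) \<in> adj A"
    unfolding adj_iff[OF A(1)] using v step_append[of u z] A(1) by (metis subsetD)
  \<comment> \<open>A second neighbour \<open>y\<close> in Y, reached by label 1 or 2, would lie
    beyond \<open>v\<close>; then \<open>v\<close>, between \<open>u\<close> and \<open>y\<close>,
    would be in Y by convexity.\<close>
  moreover have False if y: "y \<in> Y" "(y, v) \<in> adj A" and "joined k y v" "k \<in> {1, 2}" for y k
  proof -
    have "reduced y" "reduced v" using y(2) A(1) by (auto simp: adj_def dest: verticesD)
    with \<open>joined k y v\<close> obtain b where "v = step y (k, b)"
      unfolding joined_iff[OF \<open>reduced y\<close> \<open>reduced v\<close>] by blast
    then show False
      using v y(1) \<open>k \<in> {1, 2}\<close> convex[of u y v]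
      by (cases y "(k, b)" rule: step_cases) auto
  qed
  ultimately show "v \<in> cut_vertices A Y"
    using v unfolding cut_vertices_def by blast
qed

text \<open>A word that does not extend \<open>v\<close> is linked to the root through its prefixes,
  which avoid \<open>v\<close>, and so is the predecessor \<open>u\<close> of \<open>v\<close>, an
  element of Y. A path that starts beyond \<open>v\<close> and avoids \<open>v\<close> stays beyond
  it.\<close>

lemma separated_cut_vertex_iff:
  assumes "v \<in> cut_vertices A Y"
  shows "separated A Y v x \<longleftrightarrow> x \<in> A \<and> x \<noteq> v \<and> prefix v x"
proof -
  from assms obtain u z where v: "v = u @ [z]" "u @ [z] \<in> A" "u \<in> Y" "u @ [z] \<notin> Y"
    unfolding cut_vertices_eq by blast
  have "prefix v x" if "separated A Y v x"
  proof (rule ccontr)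
    assume x: "\<not> prefix v x"
    have path: "([], y) \<in> (adj (A - {v}))\<^sup>*" if "y \<in> A" "\<not> prefix v y" for y
      using that
    proof (induction y rule: rev_induct)
      case (snoc a y)
      have y: "y \<in> A" "\<not> prefix v y"
        using snoc.prems closed[of "y @ [a]" y] by auto
      moreover have "step y a = y @ [a]" "1 \<le> fst a" "y \<noteq> v" "y @ [a] \<noteq> v" "A - {v} \<subseteq> vertices"
        using y snoc.prems step_append[of y a] A(1) by auto
      ultimately have "(y, y @ [a]) \<in> adj (A - {v})"
        using snoc.prems(1) by (auto simp: adj_iff intro!: exI[of _ a])
      with snoc.IH[OF y] show ?case by auto
    qed simp
    have "u \<in> A" "\<not> prefix v u"
      using closed[OF v(2), of u] v(1) by (auto dest: prefix_length_le)
    then have "(x, u) \<in> (adj (A - {v}))\<^sup>*"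
      using path[of x] path[of u] x that sym_rtrancl[OF sym_adj[of "A - {v}"]]
      by (metis DiffD1 rtrancl_trans separated_def symD)
    with v(3) that show False by (auto simp: separated_def)
  qed
  \<comment> \<open>By convexity no element of Y lies beyond \<open>v\<close>: otherwise
    \<open>v\<close>, which follows \<open>u\<close> in Y, would be in Y as well.\<close>
  moreover have False if "prefix v x" "y \<in> Y" "(x, y) \<in> (adj (A - {v}))\<^sup>*" for y
  proof -
    have "(x, y) \<in> (steps_in (A - {v}))\<^sup>*"
      using that(3) A(1) rtrancl_mono[OF adj_subset_steps_in[of "A - {v}"]] by blast
    then have "prefix v y"
      using steps_in_crossing(1)[of x y "A - {v}" v] that(1) v(1) by blast
    then show False
      using convex[of u y v] v that by auto
  qed
  ultimately show ?thesis
    by (auto simp: separated_def)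
qed

lemma prune_eq:
  "prune A Y = {x \<in> A. no_exit Y x}"
proof -
  have "prune A Y = {x \<in> A. \<forall>v\<in>cut_vertices A Y. \<not> prefix v x}"
    unfolding prune_def using separated_cut_vertex_iff by auto
  also have "\<dots> = {x \<in> A. no_exit Y x}"
    unfolding cut_vertices_eq no_exit_def using closed by blast
  finally show ?thesis .
qed

end

lemma set_reduce_subset: "set (reduce u) \<subseteq> set u"
proof (induction u)
  case (Cons x u)
  have "set (cons_reduce x v) \<subseteq> insert x (set v)" for v
    by (cases "(x, v)" rule: cons_reduce.cases) auto
  with Cons show ?case by (fastforce simp: reduce_def)
qed (simp add: reduce_def)

section \<open>Membership in the pruned tree and the labels at its vertices\<close>

locale word_list =
  fixes w :: "nat \<Rightarrow> word"
  assumes enumerates: "w ` {1..} = words - {[]}"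
begin

text \<open>The index is shifted: the list starts at 1 and stage \<open>Suc j\<close> is pruned with
  \<open>Y_set w (Suc j)\<close>, so \<open>Y 0\<close> belongs to the first word.\<close>

abbreviation Y :: "nat \<Rightarrow> word set" where "Y j \<equiv> Y_set w (Suc j)"
abbreviation N :: "nat \<Rightarrow> nat" where "N j \<equiv> n_of w (Suc j)"
abbreviation T :: "word set" where "T \<equiv> tree_star w"

lemma n_of_Suc: "2 \<le> N j" "w (Suc j) \<in> words_upto (N j)"
proof -
  have "w (Suc j) \<in> words" using enumerates by (auto simp: image_def)
  then obtain n where "w (Suc j) \<in> words_upto n" by (auto simp: words_def)
  then have "2 \<le> max 2 n \<and> w (Suc j) \<in> words_upto (max 2 n)"
    by (force simp: words_upto_def)
  then have "2 \<le> N j \<and> w (Suc j) \<in> words_upto (N j)"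
    unfolding n_of_def by (rule LeastI)
  then show "2 \<le> N j" "w (Suc j) \<in> words_upto (N j)" by auto
qed

text \<open>The alternating word uses labels 1 and 2, the listed word and the lines use labels up to
  \<open>N j\<close>, and free reduction creates no new letters. This is the source of all label
  bounds.\<close>

lemma Y_words_upto:
  assumes "v \<in> Y j"
  shows "v \<in> words_upto (N j)"
proof -
  have hat: "w_hat w (Suc j) \<in> words_upto (N j)"
    using alternating_letters n_of_Suc(1)[of j] by (fastforce simp: words_upto_def w_hat_def)
  have red: "reduce x \<in> words_upto n" if "x \<in> words_upto n" for x n
    using that set_reduce_subset by (fastforce simp: words_upto_def)
  have app: "x @ y \<in> words_upto n" if "x \<in> words_upto n" "y \<in> words_upto n" for x y n
    using that by (auto simp: words_upto_def)
  have "take i (w (Suc j)) \<in> words_upto (N j)" for i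
    using n_of_Suc(2)[of j] by (auto simp: words_upto_def dest: in_set_takeD)
  then have Z: "u \<in> words_upto (N j)" if "u \<in> Z_set w (Suc j)" for u
    using that hat red app by (auto simp: Z_set_def)
  from assms show ?thesis
  proof (cases rule: Y_set_cases)
    case (1 u s)
    have "letter_power s r \<in> words_upto (N j)" for r
      using 1(2) by (auto simp: letter_power_def words_upto_def)
    with 1 Z[OF 1(1)] show ?thesis using red app by (auto simp: L_line_def)
  qed (use Z in auto)
qed

text \<open>The description itself shows that each stage is prefix-closed and contains the root,
  which is what \<open>prune_eq\<close> requires for the next one.\<close>

lemma tree_stage_iff: "x \<in> tree_stage w j \<longleftrightarrow> x \<in> vertices \<and> (\<forall>i<j. no_exit (Y i) x)"
proof (induction j arbitrary: x)
  case (Suc j)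
  have "tree_stage w j \<subseteq> vertices"
    using Suc.IH by blast
  moreover have "[] \<in> tree_stage w j"
    by (subst Suc.IH) (auto simp: vertices_def words_iff reduced_def no_exit_def)
  moreover have "u \<in> tree_stage w j" if "v \<in> tree_stage w j" "prefix u v" for u v
    using that vertices_prefix no_exit_prefix unfolding Suc.IH by blast
  ultimately have "tree_stage w (Suc j) = {x \<in> tree_stage w j. no_exit (Y j) x}"
    using prune_eq[OF _ _ _ Y_set_convex[where j = "Suc j"] Y_set_top[where j = "Suc j"]] by simp
  then show ?case
    using Suc.IH[of x] by (auto simp: less_Suc_eq)
qed simp

lemma tree_inf_iff: "x \<in> tree_inf w \<longleftrightarrow> x \<in> vertices \<and> (\<forall>i. no_exit (Y i) x)"
  unfolding tree_inf_def INT_iff tree_stage_iff by auto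

lemma tree_inf_prefix: "v \<in> tree_inf w \<Longrightarrow> prefix u v \<Longrightarrow> u \<in> tree_inf w"
  using vertices_prefix no_exit_prefix unfolding tree_inf_iff by blast

text \<open>Inside \<open>Y j\<close>, a step away from the root with a label above 2 must stay in
  \<open>Y j\<close>, where labels are bounded. Outside all of them nothing forbids an extension, so
  every label occurs.\<close>

lemma infinite_valence_iff:
  assumes u: "u \<in> tree_inf w"
  shows "infinite (adj (tree_inf w) `` {u}) \<longleftrightarrow> (\<forall>j. u \<notin> Y j)"
proof
  have sub: "tree_inf w \<subseteq> vertices" by (auto simp: tree_inf_iff)
  show "\<forall>j. u \<notin> Y j" if inf: "infinite (adj (tree_inf w) `` {u})"
  proof (intro allI notI)
    fix j assume j: "u \<in> Y j"
    have "fst x \<in> {1..N j}" if "1 \<le> fst x" "step u x \<in> tree_inf w" for x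
    proof (cases u x rule: step_cases)
      case (1 v)
      with Y_words_upto[OF j] that(1) show ?thesis by (auto simp: words_upto_def)
    next
      case 2
      then have "fst x \<in> {1, 2} \<or> u @ [x] \<in> Y j"
        using that(2) j by (auto simp: tree_inf_iff no_exit_def)
      then show ?thesis
        using Y_words_upto[of "u @ [x]" j] n_of_Suc(1)[of j] by (auto simp: words_upto_def)
    qed
    then have "adj (tree_inf w) `` {u} \<subseteq> step u ` ({1..N j} \<times> UNIV)"
      by (fastforce simp: adj_iff[OF sub])
    with inf show False
      using finite_subset by fastforce
  qed
  show "infinite (adj (tree_inf w) `` {u})" if "\<forall>j. u \<notin> Y j"
  proof -
    have "step u x \<in> tree_inf w" if x: "1 \<le> fst x" for x
    proof (cases u x rule: step_cases)
      case (1 v)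
      then show ?thesis using tree_inf_prefix[OF u, of v] by simp
    next
      case 2
      have "u @ [x] \<in> vertices"
        using step_in_vertices[of u x] x u sub 2 by auto
      then show ?thesis
        using u \<open>\<forall>j. u \<notin> Y j\<close> 2 by (auto simp: tree_inf_iff no_exit_def)
    qed
    then have "(\<lambda>k. step u (k, True)) ` {1..} \<subseteq> adj (tree_inf w) `` {u}"
      using u by (auto simp: adj_iff[OF sub] step_inject split_paired_Ex)
    moreover have "infinite ((\<lambda>k. step u (k, True)) ` {1..})"
      by (subst finite_image_iff) (auto simp: inj_on_def step_inject infinite_Ici)
    ultimately show ?thesis
      using finite_subset by blast
  qed
qed

text \<open>The stages forbid leaving a \<open>Y j\<close> by an edge with a label above 2; the last
  removal forbids such an edge to start outside all of them. Later arguments use this description in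
  place of the construction.\<close>

lemma tree_star_iff:
  "x \<in> T \<longleftrightarrow> x \<in> vertices \<and> (\<forall>u z. prefix (u @ [z]) x \<and> fst z \<notin> {1, 2} \<longrightarrow>
     (\<exists>j. u \<in> Y j) \<and> (\<forall>j. u \<in> Y j \<longrightarrow> u @ [z] \<in> Y j))"
proof -
  have "x \<in> T \<longleftrightarrow> x \<in> tree_inf w \<and>
      \<not> (\<exists>u k b. prefix (u @ [(k, b)]) x \<and> k \<notin> {1, 2} \<and> u \<in> tree_inf w \<and> infinite (adj (tree_inf w) `` {u}))"
    unfolding tree_star_def prefix_def append_assoc by blast
  also have "\<dots> \<longleftrightarrow> x \<in> tree_inf w \<and>
      \<not> (\<exists>u z. prefix (u @ [z]) x \<and> fst z \<notin> {1, 2} \<and> u \<in> tree_inf w \<and> infinite (adj (tree_inf w) `` {u}))"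
    by (simp add: split_paired_Ex)
  also have "\<dots> \<longleftrightarrow> x \<in> tree_inf w \<and>
      \<not> (\<exists>u z. prefix (u @ [z]) x \<and> fst z \<notin> {1, 2} \<and> (\<forall>j. u \<notin> Y j))"
    using infinite_valence_iff tree_inf_prefix append_prefixD by blast
  finally show ?thesis
    unfolding tree_inf_iff no_exit_def by blast
qed

lemma tree_star_vertices: "v \<in> T \<Longrightarrow> v \<in> vertices"
  by (simp add: tree_star_iff)

lemma tree_star_reduced: "v \<in> T \<Longrightarrow> reduced v"
  by (auto dest: tree_star_vertices verticesD)

lemma Nil_in_tree_star: "[] \<in> T"
  by (auto simp: tree_star_iff vertices_def words_iff reduced_def)

lemma tree_star_prefix: "v \<in> T \<Longrightarrow> prefix u v \<Longrightarrow> u \<in> T"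
  using vertices_prefix prefix_order.trans unfolding tree_star_iff by blast

text \<open>The criterion has the same form for steps towards the root, although the target is then
  always in the tree: the right side holds because the edge satisfied the condition when traversed
  the other way, and \<open>Y_set_top\<close> excludes that it enters a \<open>Y j\<close>.\<close>

lemma step_in_tree_star:
  assumes v: "v \<in> T" and x: "1 \<le> fst x"
  shows "step v x \<in> T \<longleftrightarrow> fst x \<in> {1, 2} \<or> ((\<exists>j. v \<in> Y j) \<and> (\<forall>j. v \<in> Y j \<longrightarrow> step v x \<in> Y j))"
proof (cases v x rule: step_cases)
  case (1 u)
  then have "fst x \<in> {1, 2} \<or> ((\<exists>j. u \<in> Y j) \<and> (\<forall>j. u \<in> Y j \<longrightarrow> v \<in> Y j))"
    using v unfolding tree_star_iff by (metis fst_inv_letter prefix_order.refl)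
  moreover have "fst x \<in> {1, 2}" if "v \<in> Y j" "u \<notin> Y j" for j
    using Y_set_top[of u "inv_letter x"] that 1 by simp
  ultimately show ?thesis
    using 1 tree_star_prefix[OF v, of u] by auto
next
  case 2
  have "v @ [x] \<in> vertices"
    using step_in_vertices[OF tree_star_vertices[OF v] x] 2 by simp
  with 2 v show ?thesis by (auto simp: tree_star_iff)
qed

text \<open>This makes the labels of incoming and outgoing edges at \<open>v\<close> agree, so that
  one loop per missing label completes both families.\<close>

lemma opposite_step_in_tree_star:
  assumes v: "v \<in> T" and i: "1 \<le> i" and s: "step v (i, b) \<in> T"
  shows "step v (i, \<not> b) \<in> T"
proof (cases "i \<in> {1, 2}")
  case False
  have red: "reduced v" using v by (rule tree_star_reduced)
  from False s have Y: "\<exists>j. v \<in> Y j" "\<forall>j. v \<in> Y j \<longrightarrow> step v (i, b) \<in> Y j"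
    using step_in_tree_star[OF v, of "(i, b)"] i by auto
  have "step v (i, \<not> b) \<in> Y j" if j: "v \<in> Y j" for j
  proof (rule Y_set_opposite_step[OF j])
    show "step v (i, b) \<in> Y j" using Y j by blast
    with j have "v \<in> words_upto (N j)" "step v (i, b) \<in> words_upto (N j)"
      using Y_words_upto by auto
    \<comment> \<open>The letter with label \<open>i\<close> is the last one of \<open>v\<close> or
      of \<open>step v (i, b)\<close>, and both words lie in \<open>Y j\<close>.\<close>
    then show "i \<in> {1..N j}"
      by (cases v "(i, b)" rule: step_cases) (auto simp: words_upto_def)
  qed
  with Y False i show ?thesis
    using step_in_tree_star[OF v, of "(i, \<not> b)"] by auto
qed (use step_in_tree_star[OF v, of "(i, \<not> b)"] i in auto)

lemma E_labels_iff:
  assumes v: "v \<in> T"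
  shows "i \<in> E_labels w v \<longleftrightarrow> 1 \<le> i \<and> step v (i, b) \<in> T"
proof -
  have "(\<exists>u\<in>T. arrow u i = v) \<longleftrightarrow> step v (i, False) \<in> T"
    using tree_star_reduced v arrow_eq_step step_Not[of _ i True] step_Not[of _ i False]
    by (metis (full_types))
  moreover have "step v (i, False) \<in> T \<longleftrightarrow> step v (i, b) \<in> T" if "1 \<le> i"
    using opposite_step_in_tree_star[OF v that, of True] opposite_step_in_tree_star[OF v that, of False]
    by (cases b) auto
  ultimately show ?thesis
    by (auto simp: E_labels_def)
qed

text \<open>The criterion for a step in the tree, applied from each end of the edge, gives the two
  implications.\<close>

lemma Y_edge_iff:
  assumes "v \<in> T" "arrow v i \<in> T" "3 \<le> i"
  shows "v \<in> Y j \<longleftrightarrow> arrow v i \<in> Y j"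
proof -
  let ?u = "step v (i, True)"
  have red: "reduced v" using assms(1) by (rule tree_star_reduced)
  then have u: "arrow v i = ?u" by (rule arrow_eq_step)
  have "v \<in> Y j \<longrightarrow> ?u \<in> Y j"
    using step_in_tree_star[of v "(i, True)"] assms u by auto
  moreover have "?u \<in> Y j \<longrightarrow> v \<in> Y j"
    using step_in_tree_star[of ?u "(i, False)"] assms u red step_Not[of v i True] by auto
  ultimately show ?thesis using u by auto
qed

lemma E_labels_subset_Y:
  assumes "v \<in> T" "v \<in> Y j"
  shows "E_labels w v \<subseteq> {1..N j}"
proof
  fix i assume "i \<in> E_labels w v"
  then have i: "1 \<le> i" "step v (i, True) \<in> T" using E_labels_iff[OF assms(1)] by auto
  then have "i \<in> {1, 2} \<or> step v (i, True) \<in> Y j"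
    using step_in_tree_star[OF assms(1), of "(i, True)"] assms(2) by auto
  with i show "i \<in> {1..N j}"
    using n_of_Suc(1)[of j] Y_words_upto[OF assms(2)] Y_words_upto[of "step v (i, True)" j]
    by (cases v "(i, True)" rule: step_cases) (auto simp: words_upto_def)
qed

lemma E_labels_subset_not_Y:
  assumes "v \<in> T" "\<And>j. v \<notin> Y j"
  shows "E_labels w v \<subseteq> {1..2}"
  using step_in_tree_star[OF assms(1)] assms(2) by (fastforce simp: E_labels_iff[OF assms(1), of _ True])

text \<open>The set over which the least element is taken is nonempty: it contains
  \<open>N j\<close> if \<open>v\<close> is in \<open>Y j\<close>, and 2 if \<open>v\<close> is in
  none of them.\<close>

lemma n_vertex:
  assumes "v \<in> T"
  shows "2 \<le> n_vertex w v" "E_labels w v \<subseteq> {1..n_vertex w v}"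
proof -
  have "\<exists>n. 2 \<le> n \<and> E_labels w v \<subseteq> {1..n}"
    using E_labels_subset_Y[OF assms] E_labels_subset_not_Y[OF assms] n_of_Suc(1) by blast
  then have "2 \<le> n_vertex w v \<and> E_labels w v \<subseteq> {1..n_vertex w v}"
    unfolding n_vertex_def by (rule LeastI_ex)
  then show "2 \<le> n_vertex w v" "E_labels w v \<subseteq> {1..n_vertex w v}" by auto
qed

end


section \<open>The Hawaiian earring\<close>

text \<open>On \<open>circle i\<close> the equation reads x^2 + y^2 = 2 y / i, so away from the
  origin this formula returns i.\<close>

definition circle_index :: "real \<times> real \<Rightarrow> real" where
  "circle_index p = 2 * snd p / ((fst p)\<^sup>2 + (snd p)\<^sup>2)"

text \<open>On a circle x / y is the cotangent of pi t, that is, the tangent of pi/2 - pi t. Using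
  the arctangent makes the recovered time continuous on the whole open upper half plane.\<close>

definition circle_time :: "real \<times> real \<Rightarrow> real" where
  "circle_time p = 1 / 2 - arctan (fst p / snd p) / pi"

lemma circle_param_half_angle:
  "circle_param i t = (2 * sin (pi * t) * cos (pi * t) / real i, 2 * (sin (pi * t))\<^sup>2 / real i)"
  using sin_double[of "pi * t"] cos_double_sin[of "pi * t"]
  by (simp add: circle_param_def mult.assoc)

lemma circle_param_inverse:
  assumes "1 \<le> i" "0 < t" "t < 1"
  shows "0 < snd (circle_param i t)"
    and "circle_index (circle_param i t) = real i"
    and "circle_time (circle_param i t) = t"
proof -
  have s: "0 < sin (pi * t)"
    using assms by (intro sin_gt_zero) auto
  then show "0 < snd (circle_param i t)"
    using assms by (simp add: circle_param_half_angle)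
  have "(fst (circle_param i t))\<^sup>2 + (snd (circle_param i t))\<^sup>2
      = 4 * (sin (pi * t))\<^sup>2 * ((cos (pi * t))\<^sup>2 + (sin (pi * t))\<^sup>2) / (real i)\<^sup>2"
  proof -
    have "(2 * s * c / r)\<^sup>2 + (2 * s\<^sup>2 / r)\<^sup>2 = 4 * s\<^sup>2 * (c\<^sup>2 + s\<^sup>2) / r\<^sup>2" for s c r :: real
    proof -
      have "(2 * s * c)\<^sup>2 + (2 * s\<^sup>2)\<^sup>2 = 4 * s\<^sup>2 * (c\<^sup>2 + s\<^sup>2)" by algebra
      then show ?thesis by (simp add: power_divide flip: add_divide_distrib)
    qed
    then show ?thesis by (simp add: circle_param_half_angle)
  qed
  then have "(fst (circle_param i t))\<^sup>2 + (snd (circle_param i t))\<^sup>2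
      = 4 * (sin (pi * t))\<^sup>2 / (real i)\<^sup>2"
    by simp
  then show "circle_index (circle_param i t) = real i"
    using s assms by (simp add: circle_index_def circle_param_half_angle field_simps power2_eq_square)
  have "fst (circle_param i t) / snd (circle_param i t) = tan (pi / 2 - pi * t)"
    using s assms by (simp add: circle_param_half_angle tan_def sin_diff cos_diff power2_eq_square)
  moreover have "- (pi / 2) < pi / 2 - pi * t" "pi / 2 - pi * t < pi / 2"
    using assms mult_strict_left_mono[of t 1 pi] by auto
  ultimately have "arctan (fst (circle_param i t) / snd (circle_param i t)) = pi / 2 - pi * t"
    by (metis arctan_tan)
  then show "circle_time (circle_param i t) = t"
    by (simp add: circle_time_def diff_divide_distrib)
qed

lemma circle_param_inject:
  assumes "1 \<le> i" "t \<in> {0<..<1}" "1 \<le> j" "s \<in> {0<..<1}"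
  shows "circle_param i t = circle_param j s \<longleftrightarrow> i = j \<and> t = s"
  using assms circle_param_inverse[of i t] circle_param_inverse[of j s]
  by (metis greaterThanLessThan_iff of_nat_eq_iff)

lemma circle_param_neq_0:
  assumes "1 \<le> i" "t \<in> {0<..<1}"
  shows "circle_param i t \<noteq> (0, 0)"
  using assms circle_param_inverse(1)[of i t] by auto

lemma circle_param_01 [simp]: "circle_param i 0 = (0, 0)" "circle_param i 1 = (0, 0)"
  by (simp_all add: circle_param_def)

lemma circle_eq_image:
  assumes "1 \<le> i"
  shows "circle i = circle_param i ` {0..1}"
proof (intro equalityI subsetI)
  fix p assume "p \<in> circle i"
  then have "(1 - real i * snd p)\<^sup>2 + (real i * fst p)\<^sup>2 = 1"
    using assms by (auto simp: circle_def field_simps power2_eq_square)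
  then obtain t where t: "0 \<le> t" "t < 2 * pi" "1 - real i * snd p = cos t" "real i * fst p = sin t"
    using sincos_total_2pi by metis
  then have "circle_param i (t / (2 * pi)) = p"
    using assms by (auto simp: circle_param_def prod_eq_iff field_simps)
  with t show "p \<in> circle_param i ` {0..1}"
    by (intro image_eqI[of _ _ "t / (2 * pi)"]) auto
next
  fix p assume "p \<in> circle_param i ` {0..1}"
  then show "p \<in> circle i"
    using assms by (auto simp: circle_def circle_param_def power_divide
        simp flip: add_divide_distrib diff_divide_distrib)
qed

lemma circle_param_in_hawaiian: "1 \<le> i \<Longrightarrow> t \<in> {0..1} \<Longrightarrow> circle_param i t \<in> hawaiian"
  by (auto simp: hawaiian_def circle_eq_image intro!: bexI[of _ i])

lemma hawaiian_cases:
  assumes "p \<in> hawaiian"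
  obtains "p = (0, 0)" | i t where "1 \<le> i" "t \<in> {0<..<1}" "p = circle_param i t"
proof -
  from assms obtain i t where it: "1 \<le> i" "t \<in> {0..1}" "p = circle_param i t"
    by (auto simp: hawaiian_def circle_eq_image)
  show thesis
  proof (cases "t \<in> {0, 1}")
    case True
    with it that(1) show thesis by auto
  next
    case False
    with it that(2)[of i t] show thesis by auto
  qed
qed

text \<open>Index and time are continuous on the open upper half plane. The index takes integer
  values on the earring there, so a window of radius 1/2 isolates one circle.\<close>

lemma open_circle_param_image:
  assumes "open S" "S \<subseteq> {0<..<1}" "1 \<le> i"
  shows "openin (top_of_set hawaiian) (circle_param i ` S)"
proof -
  define W where "W = {p :: real \<times> real. 0 < snd p}"
  have "open W"
    unfolding W_def by (intro open_Collect_less continuous_intros)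
  have "continuous_on W circle_index"
    unfolding circle_index_def W_def by (intro continuous_intros) (auto simp: sum_power2_eq_zero_iff)
  moreover have "continuous_on W circle_time"
    unfolding circle_time_def W_def by (intro continuous_intros) auto
  ultimately have "open ((W \<inter> circle_index -` {real i - 1/2<..<real i + 1/2}) \<inter> (W \<inter> circle_time -` S))"
    using \<open>open W\<close> assms(1) by (intro open_Int continuous_open_preimage) auto
  moreover have "circle_param i ` S =
      hawaiian \<inter> ((W \<inter> circle_index -` {real i - 1/2<..<real i + 1/2}) \<inter> (W \<inter> circle_time -` S))"
  proof (intro equalityI subsetI)
    fix p assume "p \<in> circle_param i ` S"
    then obtain t where "t \<in> S" "0 < t" "t < 1" "p = circle_param i t"
      using assms(2) by (auto simp: subset_eq)
    then show "p \<in> hawaiian \<inter> ((W \<inter> circle_index -` {real i - 1/2<..<real i + 1/2}) \<inter> (W \<inter> circle_time -` S))"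
      using circle_param_inverse[of i t] circle_param_in_hawaiian[of i t] assms(3) by (simp add: W_def)
  next
    fix p assume p: "p \<in> hawaiian \<inter> ((W \<inter> circle_index -` {real i - 1/2<..<real i + 1/2}) \<inter> (W \<inter> circle_time -` S))"
    then have "p \<in> hawaiian" by blast
    then show "p \<in> circle_param i ` S"
    proof (cases rule: hawaiian_cases)
      case (2 k t)
      with p circle_param_inverse[of k t] have "\<bar>real k - real i\<bar> < 1 / 2" "t \<in> S"
        by auto
      with 2 show ?thesis by (cases "k = i") auto
    qed (use p in \<open>auto simp: W_def\<close>)
  qed
  ultimately show ?thesis by auto
qed

lemma zero_in_U_inf: "1 \<le> m \<Longrightarrow> (0, 0) \<in> U_inf m"
  by (auto simp: U_inf_def circle_def power_divide intro!: bexI[of _ m])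

lemma U_inf_subset: "1 \<le> m \<Longrightarrow> U_inf m \<subseteq> hawaiian"
  using circle_param_in_hawaiian by (fastforce simp: U_inf_def hawaiian_def)

lemma circle_param_in_U_inf_iff:
  assumes "1 \<le> m" "1 \<le> i" "t \<in> {0<..<1}"
  shows "circle_param i t \<in> U_inf m \<longleftrightarrow> m \<le> i \<or> t < 3/8 \<or> 5/8 < t"
proof
  assume "circle_param i t \<in> U_inf m"
  then obtain k s where k: "1 \<le> k" "s \<in> {0..1}" "m \<le> k \<or> s < 3/8 \<or> 5/8 < s"
    "circle_param i t = circle_param k s"
  proof -
    consider k s where "k \<in> {1..<m}" "s \<in> {0..<3/8} \<union> {5/8<..1}" "circle_param i t = circle_param k s"
      | k where "m \<le> k" "circle_param i t \<in> circle k"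
      using \<open>circle_param i t \<in> U_inf m\<close> unfolding U_inf_def by blast
    then show thesis
    proof cases
      case 1
      then show ?thesis by (intro that[of k s]) auto
    next
      case 2
      with assms(1) obtain s where "s \<in> {0..1}" "circle_param i t = circle_param k s"
        using circle_eq_image[of k] by auto
      with 2 assms(1) show ?thesis by (intro that[of k s]) auto
    qed
  qed
  have "s \<noteq> 0" "s \<noteq> 1"
    using k(4) circle_param_neq_0[OF assms(2,3)] by auto
  with k have "i = k \<and> t = s"
    using assms circle_param_inject[of i t k s] by auto
  with k show "m \<le> i \<or> t < 3/8 \<or> 5/8 < t" by auto
next
  assume "m \<le> i \<or> t < 3/8 \<or> 5/8 < t"
  then show "circle_param i t \<in> U_inf m"
  proof (cases "m \<le> i")
    case True
    then have "circle_param i t \<in> circle i"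
      using assms by (auto simp: circle_eq_image)
    with True show ?thesis unfolding U_inf_def by blast
  next
    case False
    with \<open>m \<le> i \<or> t < 3/8 \<or> 5/8 < t\<close> have "t \<in> {0..<3/8} \<union> {5/8<..1}" "i \<in> {1..<m}"
      using assms by auto
    then show ?thesis unfolding U_inf_def by blast
  qed
qed

lemma U_inf_antimono:
  assumes "1 \<le> m" "m \<le> n"
  shows "U_inf n \<subseteq> U_inf m"
proof
  fix p assume p: "p \<in> U_inf n"
  then have "p \<in> hawaiian" using U_inf_subset[of n] assms by auto
  then show "p \<in> U_inf m"
    by (cases rule: hawaiian_cases)
       (use assms p in \<open>auto simp: zero_in_U_inf circle_param_in_U_inf_iff\<close>)
qed

text \<open>Its complement in the earring consists of finitely many compact middle arcs.\<close>

lemma openin_U_inf: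
  assumes "1 \<le> m"
  shows "openin (top_of_set hawaiian) (U_inf m)"
proof -
  define K where "K = (\<Union>i\<in>{1..<m}. circle_param i ` {3/8..5/8})"
  have "compact K"
    unfolding K_def circle_param_def
    by (intro compact_UN compact_continuous_image continuous_intros) auto
  moreover have "U_inf m = hawaiian - K"
  proof (intro equalityI subsetI)
    fix p assume p: "p \<in> U_inf m"
    then have "p \<in> hawaiian" using U_inf_subset[OF assms] by auto
    moreover have "p \<notin> K"
      using p circle_param_in_U_inf_iff[OF assms] by (fastforce simp: K_def)
    ultimately show "p \<in> hawaiian - K" by blast
  next
    fix p assume p: "p \<in> hawaiian - K"
    then have "p \<in> hawaiian" by blast
    then show "p \<in> U_inf m"
    proof (cases rule: hawaiian_cases)
      case (2 i t)
      with p have "m \<le> i \<or> t < 3/8 \<or> 5/8 < t" by (force simp: K_def)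
      with 2 show ?thesis using circle_param_in_U_inf_iff[OF assms] by simp
    qed (use zero_in_U_inf[OF assms] in simp)
  qed
  ultimately show ?thesis
    by (metis Diff_eq compact_imp_closed open_Compl openin_open_Int)
qed

lemma U_arc_subset_hawaiian: "1 \<le> i \<Longrightarrow> U_arc i \<subseteq> hawaiian"
  using circle_param_in_hawaiian by (auto simp: U_arc_def)


section \<open>Topologies glued from charts\<close>

text \<open>Gluing data: every chart is identified by \<open>q\<close> with a subset of
  \<open>H\<close>, and \<open>overlap\<close> makes the identifications compatible. Taking both
  sets equal there shows that chart images are open.\<close>

locale charts =
  fixes X :: "'a set" and H :: "'b topology" and q :: "'a \<Rightarrow> 'b" and \<U> :: "'a set set"
  assumes cover: "\<Union>\<U> = X"
    and inj_chart: "\<And>U. U \<in> \<U> \<Longrightarrow> inj_on q U"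
    and overlap: "\<And>U V. U \<in> \<U> \<Longrightarrow> V \<in> \<U> \<Longrightarrow> openin H (q ` (U \<inter> V))"
begin

definition chart_topology :: "'a topology" where
  "chart_topology = topology (\<lambda>S. S \<subseteq> X \<and> (\<forall>U\<in>\<U>. openin H (q ` (S \<inter> U))))"

lemma openin_chart_topology:
  "openin chart_topology S \<longleftrightarrow> S \<subseteq> X \<and> (\<forall>U\<in>\<U>. openin H (q ` (S \<inter> U)))"
proof -
  have "istopology (\<lambda>S. S \<subseteq> X \<and> (\<forall>U\<in>\<U>. openin H (q ` (S \<inter> U))))"
    unfolding istopology_def
  proof (intro conjI allI impI)
    fix S T
    assume *: "S \<subseteq> X \<and> (\<forall>U\<in>\<U>. openin H (q ` (S \<inter> U)))" "T \<subseteq> X \<and> (\<forall>U\<in>\<U>. openin H (q ` (T \<inter> U)))"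
    then show "S \<inter> T \<subseteq> X" by blast
    show "\<forall>U\<in>\<U>. openin H (q ` (S \<inter> T \<inter> U))"
    proof
      fix U assume U: "U \<in> \<U>"
      \<comment> \<open>Injectivity on the chart is what lets images commute with
        intersections.\<close>
      have "q ` (S \<inter> T \<inter> U) = q ` (S \<inter> U) \<inter> q ` (T \<inter> U)"
        using inj_onD[OF inj_chart[OF U]] by blast
      with * U show "openin H (q ` (S \<inter> T \<inter> U))" by auto
    qed
  next
    fix K
    assume *: "\<forall>S\<in>K. S \<subseteq> X \<and> (\<forall>U\<in>\<U>. openin H (q ` (S \<inter> U)))"
    then show "\<Union>K \<subseteq> X" by blast
    show "\<forall>U\<in>\<U>. openin H (q ` (\<Union>K \<inter> U))"
    proof
      fix U assume U: "U \<in> \<U>"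
      have "q ` (\<Union>K \<inter> U) = (\<Union>S\<in>K. q ` (S \<inter> U))" by blast
      with * U show "openin H (q ` (\<Union>K \<inter> U))" by auto
    qed
  qed
  then show ?thesis
    by (simp add: chart_topology_def topology_inverse')
qed

lemma openin_chart: "U \<in> \<U> \<Longrightarrow> openin chart_topology U"
  using cover overlap by (auto simp: openin_chart_topology)

lemma topspace_chart_topology [simp]: "topspace chart_topology = X"
proof
  show "topspace chart_topology \<subseteq> X"
    using openin_topspace openin_chart_topology by blast
  show "X \<subseteq> topspace chart_topology"
    using openin_chart openin_subset cover by blast
qed

lemma openin_image_chart: "U \<in> \<U> \<Longrightarrow> openin H (q ` U)"
  using overlap[of U U] by simp

lemma open_map_chart_topology: "open_map chart_topology H q"
  unfolding open_map_def
proof (intro allI impI)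
  fix S assume S: "openin chart_topology S"
  then have "q ` S = (\<Union>U\<in>\<U>. q ` (S \<inter> U))"
    using cover openin_chart_topology by blast
  with S show "openin H (q ` S)" by (auto simp: openin_chart_topology)
qed

lemma continuous_map_chart_topology: "continuous_map chart_topology H q"
  unfolding continuous_map
proof (intro conjI allI impI)
  have "q ` U \<subseteq> topspace H" if "U \<in> \<U>" for U
    using openin_image_chart[OF that] by (rule openin_subset)
  then show "q ` topspace chart_topology \<subseteq> topspace H"
    unfolding topspace_chart_topology using cover by blast
  fix W assume W: "openin H W"
  have "q ` ({x \<in> X. q x \<in> W} \<inter> U) = W \<inter> q ` U" if "U \<in> \<U>" for U
    using that cover by blast
  with W show "openin chart_topology {x \<in> topspace chart_topology. q x \<in> W}"
    using openin_image_chart by (auto simp: openin_chart_topology)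
qed

lemma homeomorphic_map_chart:
  assumes U: "U \<in> \<U>"
  shows "homeomorphic_map (subtopology chart_topology U) (subtopology H (q ` U)) q"
proof -
  have top: "topspace (subtopology chart_topology U) = U" "topspace (subtopology H (q ` U)) = q ` U"
    using U openin_subset[OF openin_image_chart[OF U]] cover by auto
  have "openin (subtopology chart_topology U) {x \<in> U. q x \<in> W} \<longleftrightarrow> openin (subtopology H (q ` U)) W"
    if W: "W \<subseteq> q ` U" for W
  proof -
    have "openin H (q ` ({x \<in> U. q x \<in> W} \<inter> V))" if "openin H W" "V \<in> \<U>" for V
    proof -
      have "q ` ({x \<in> U. q x \<in> W} \<inter> V) = W \<inter> q ` (U \<inter> V)" by blast
      with that overlap[OF U] show ?thesis by auto
    qed
    moreover have "{x \<in> U. q x \<in> W} \<subseteq> X" using U cover by blast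
    moreover have "q ` ({x \<in> U. q x \<in> W} \<inter> U) = W" using W by blast
    ultimately have "openin chart_topology {x \<in> U. q x \<in> W} \<longleftrightarrow> openin H W"
      using U unfolding openin_chart_topology by metis
    with W show ?thesis
      by (auto simp: openin_open_subtopology openin_chart[OF U] openin_image_chart[OF U])
  qed
  then show ?thesis
    unfolding homeomorphic_map_def quotient_map_def top using inj_chart[OF U] by simp
qed

text \<open>Open charts that cover the space allow openness to be tested chart by chart, and within
  a chart \<open>q\<close> dictates it.\<close>

lemma chart_topology_unique:
  assumes "topspace T = X"
    and T: "\<And>U. U \<in> \<U> \<Longrightarrow> openin T U \<and> homeomorphic_map (subtopology T U) (subtopology H (q ` U)) q"
  shows "T = chart_topology"
proof (rule topology_eq[THEN iffD2], intro allI)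
  fix S
  have "openin T S \<longleftrightarrow> S \<subseteq> X \<and> (\<forall>U\<in>\<U>. openin T (S \<inter> U))"
  proof
    assume "openin T S"
    then show "S \<subseteq> X \<and> (\<forall>U\<in>\<U>. openin T (S \<inter> U))"
      using T assms(1) openin_subset by blast
  next
    assume *: "S \<subseteq> X \<and> (\<forall>U\<in>\<U>. openin T (S \<inter> U))"
    then have "S = (\<Union>U\<in>\<U>. S \<inter> U)" using cover by blast
    with * show "openin T S" by (metis (mono_tags, lifting) imageE openin_Union)
  qed
  moreover have "openin T (S \<inter> U) \<longleftrightarrow> openin H (q ` (S \<inter> U))" if U: "U \<in> \<U>" for U
  proof -
    have "openin T (S \<inter> U) \<longleftrightarrow> openin (subtopology T U) (S \<inter> U)"
      using T[OF U] by (auto simp: openin_open_subtopology)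
    also have "\<dots> \<longleftrightarrow> openin (subtopology H (q ` U)) (q ` (S \<inter> U))"
      using T[OF U] U assms(1) cover by (intro homeomorphic_map_openness[symmetric]) auto
    also have "\<dots> \<longleftrightarrow> openin H (q ` (S \<inter> U))"
      using openin_image_chart[OF U] by (auto simp: openin_open_subtopology)
    finally show ?thesis .
  qed
  ultimately show "openin T S \<longleftrightarrow> openin chart_topology S"
    by (simp add: openin_chart_topology)
qed

end

section \<open>Path lifting\<close>

text \<open>Separation is asked only within fibres: two lifts of the same path lie in a common fibre
  at every time.\<close>

locale local_homeo =
  fixes T :: "'a topology" and H :: "'b topology" and q :: "'a \<Rightarrow> 'b"
  assumes cont: "continuous_map T H q" and open_q: "open_map T H q"
    and locally_inj: "\<And>x. x \<in> topspace T \<Longrightarrow> \<exists>U. openin T U \<and> x \<in> U \<and> inj_on q U"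
    and separated_fibres: "\<And>x y. x \<in> topspace T \<Longrightarrow> y \<in> topspace T \<Longrightarrow> x \<noteq> y \<Longrightarrow> q x = q y \<Longrightarrow>
      \<exists>U V. openin T U \<and> openin T V \<and> x \<in> U \<and> y \<in> V \<and> U \<inter> V = {}"
begin

text \<open>The set of agreement is open by local injectivity, and its complement is open because
  the fibres are separated.\<close>

lemma lift_unique:
  assumes "connected_space D" and g: "continuous_map D T g" and h: "continuous_map D T h"
    and eq: "\<And>t. t \<in> topspace D \<Longrightarrow> q (g t) = q (h t)"
    and a: "a \<in> topspace D" "g a = h a" and t: "t \<in> topspace D"
  shows "g t = h t"
proof -
  define E where "E = {t \<in> topspace D. g t = h t}"
  define E' where "E' = {t \<in> topspace D. g t \<noteq> h t}"
  have preimage: "openin D {t \<in> topspace D. g t \<in> U}" "openin D {t \<in> topspace D. h t \<in> U}"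
    if "openin T U" for U
    using that g h by (simp_all add: continuous_map)
  have in_T: "g t \<in> topspace T" "h t \<in> topspace T" if "t \<in> topspace D" for t
    using that g h by (auto dest: continuous_map_image_subset_topspace)
  have "openin D E"
    unfolding openin_subopen[of D E]
  proof
    fix t assume t: "t \<in> E"
    then obtain U where U: "openin T U" "g t \<in> U" "inj_on q U"
      using locally_inj in_T unfolding E_def by blast
    have "{t \<in> topspace D. g t \<in> U} \<inter> {t \<in> topspace D. h t \<in> U} \<subseteq> E"
      using eq inj_onD[OF U(3)] by (auto simp: E_def)
    moreover have "t \<in> {t \<in> topspace D. g t \<in> U} \<inter> {t \<in> topspace D. h t \<in> U}"
      using t U by (simp add: E_def)
    ultimately show "\<exists>S. openin D S \<and> t \<in> S \<and> S \<subseteq> E"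
      using preimage[OF U(1)] openin_Int by blast
  qed
  moreover have "openin D E'"
    unfolding openin_subopen[of D E']
  proof
    fix t assume t: "t \<in> E'"
    then obtain U V where UV: "openin T U" "openin T V" "g t \<in> U" "h t \<in> V" "U \<inter> V = {}"
      using separated_fibres[of "g t" "h t"] in_T eq unfolding E'_def by blast
    have "{t \<in> topspace D. g t \<in> U} \<inter> {t \<in> topspace D. h t \<in> V} \<subseteq> E'"
      using UV by (auto simp: E'_def)
    moreover have "t \<in> {t \<in> topspace D. g t \<in> U} \<inter> {t \<in> topspace D. h t \<in> V}"
      using t UV by (simp add: E'_def)
    ultimately show "\<exists>S. openin D S \<and> t \<in> S \<and> S \<subseteq> E'"
      using preimage(1)[OF UV(1)] preimage(2)[OF UV(2)] openin_Int by blast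
  qed
  moreover have "topspace D \<subseteq> E \<union> E'" "E \<inter> E' = {}" "E \<noteq> {}"
    using a by (auto simp: E_def E'_def)
  ultimately have "E' = {}"
    using assms(1) unfolding connected_space_def by blast
  with t show ?thesis by (auto simp: E'_def)
qed

lemma continuous_map_inv_into:
  assumes U: "openin T U" "inj_on q U"
  shows "continuous_map (subtopology H (q ` U)) T (inv_into U q)"
proof -
  have open_image: "openin H (q ` V)" if "openin T V" for V
    using open_q that by (auto simp: open_map_def)
  have top: "topspace (subtopology H (q ` U)) = q ` U"
    using openin_subset[OF open_image[OF U(1)]] by auto
  show ?thesis
    unfolding continuous_map top
  proof (intro conjI allI impI)
    show "inv_into U q ` q ` U \<subseteq> topspace T"
      using openin_subset[OF U(1)] by (auto simp: U(2))
    fix V assume V: "openin T V"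
    have "{y \<in> q ` U. inv_into U q y \<in> V} = q ` (U \<inter> V)"
      using U(2) by auto
    with open_image[of "U \<inter> V"] open_image[OF U(1)] U(1) V
    show "openin (subtopology H (q ` U)) {y \<in> q ` U. inv_into U q y \<in> V}"
      by (auto simp: openin_open_subtopology)
  qed
qed

text \<open>The initial value is imposed only if 0 belongs to \<open>D\<close>, so that the empty
  domain \<open>{0..<0}\<close> is a legitimate starting point for an extension.\<close>

definition lift_on :: "(real \<Rightarrow> 'b) \<Rightarrow> 'a \<Rightarrow> real set \<Rightarrow> (real \<Rightarrow> 'a) \<Rightarrow> bool" where
  "lift_on f b D g \<longleftrightarrow> continuous_map (top_of_set D) T g \<and> (0 \<in> D \<longrightarrow> g 0 = b) \<and> (\<forall>t\<in>D. q (g t) = f t)"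

lemma lift_on_subset: "lift_on f b D g \<Longrightarrow> E \<subseteq> D \<Longrightarrow> lift_on f b E g"
  unfolding lift_on_def using continuous_map_from_subtopology_mono by blast

text \<open>Once \<open>g\<close> stays in \<open>U\<close>, it equals the local inverse of
  \<open>q\<close> on \<open>U\<close> composed with \<open>f\<close>. This composite is defined on
  both sides of \<open>s\<close> and is pasted to \<open>g\<close>.\<close>

lemma lift_extend:
  assumes f: "continuous_map (top_of_set {0..1}) H f"
    and s: "s \<in> {0..1}" and g: "lift_on f b {0..<s} g"
    and U: "openin T U" "inj_on q U" "p \<in> U" "q p = f s" and p: "s = 0 \<Longrightarrow> p = b"
    and a: "a < s" "g ` ({0..<s} \<inter> {a<..}) \<subseteq> U"
  obtains d h where "s < d" "lift_on f b ({0..1} \<inter> {..<d}) h"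
proof -
  have "openin H (q ` U)"
    using open_q U(1) by (auto simp: open_map_def)
  then have "openin (top_of_set {0..1}) {t \<in> {0..1}. f t \<in> q ` U}"
    using f by (simp add: continuous_map)
  moreover have "s \<in> {t \<in> {0..1}. f t \<in> q ` U}"
    using s U by (metis (mono_tags, lifting) imageI mem_Collect_eq)
  ultimately obtain e where e: "e > 0" "\<And>t. t \<in> {0..1} \<Longrightarrow> \<bar>t - s\<bar> < e \<Longrightarrow> f t \<in> q ` U"
    unfolding openin_euclidean_subtopology_iff dist_real_def by blast
  \<comment> \<open>After \<open>c\<close> both conditions hold: \<open>g\<close> is in
    \<open>U\<close> and \<open>f\<close> is in the image of \<open>U\<close>.\<close>
  define c where "c = max a (s - e)"
  define D where "D = {0..1} \<inter> {..<s + e}"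
  define A where "A = (\<lambda>i. if i then {..<s} else {c<..})"
  define k where "k = inv_into U q \<circ> f"
  define h where "h = (\<lambda>t. if t < s then g t else k t)"
  have c: "c < s" using a e by (simp add: c_def)
  have fU: "f t \<in> q ` U" if "t \<in> D" "c < t" for t
    using that e(2)[of t] by (auto simp: D_def c_def)
  have gk: "g t = k t" if "t \<in> D" "t < s" "c < t" for t
  proof -
    have "g t \<in> U" "q (g t) = f t"
      using that a g by (auto simp: D_def c_def lift_on_def)
    then show ?thesis using U(2) by (simp add: k_def flip: \<open>q (g t) = f t\<close>)
  qed
  have "continuous_map (top_of_set D) T h"
  proof (rule pasting_lemma[where I = UNIV and T = "\<lambda>i. D \<inter> A i" and f = "\<lambda>i. if i then g else k"])
    show "openin (top_of_set D) (D \<inter> A i)" for i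
      by (auto simp: A_def)
    show "continuous_map (subtopology (top_of_set D) (D \<inter> A i)) T (if i then g else k)" for i
    proof (cases i)
      case True
      have "D \<inter> A i \<subseteq> {0..<s}" using True by (auto simp: A_def D_def)
      from lift_on_subset[OF g this] show ?thesis
        using True by (simp add: subtopology_subtopology lift_on_def)
    next
      case False
      have "D \<inter> A i \<subseteq> {0..1}" by (auto simp: D_def)
      then have "continuous_map (top_of_set (D \<inter> A i)) H f"
        using f continuous_map_from_subtopology_mono by blast
      moreover have "f ` (D \<inter> A i) \<subseteq> q ` U"
        using False fU by (auto simp: A_def)
      ultimately have "continuous_map (top_of_set (D \<inter> A i)) (subtopology H (q ` U)) f"
        by (auto simp: continuous_map_in_subtopology)
      then show ?thesis
        using False continuous_map_compose[OF _ continuous_map_inv_into[OF U(1,2)]]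
        by (simp add: subtopology_subtopology k_def)
    qed
    show "(if i then g else k) t = (if j then g else k) t"
      if "t \<in> topspace (top_of_set D) \<inter> (D \<inter> A i) \<inter> (D \<inter> A j)" for i j t
      using that gk[of t] by (auto simp: A_def split: if_splits)
    show "\<exists>j. j \<in> UNIV \<and> t \<in> D \<inter> A j \<and> h t = (if j then g else k) t"
      if "t \<in> topspace (top_of_set D)" for t
      using that c by (intro exI[of _ "t < s"]) (auto simp: A_def h_def)
  qed
  moreover have "h 0 = b"
  proof (cases "s = 0")
    case True
    then have "k 0 = p" using inv_into_f_f[OF U(2,3)] U(4) by (simp add: k_def)
    with True p show ?thesis by (simp add: h_def)
  qed (use s g in \<open>auto simp: h_def lift_on_def\<close>)
  moreover have "q (h t) = f t" if "t \<in> D" for t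
  proof (cases "t < s")
    case True
    with that g show ?thesis by (auto simp: h_def lift_on_def D_def)
  next
    case False
    with that c have "f t \<in> q ` U" using fU[of t] by auto
    with False show ?thesis by (simp add: h_def k_def f_inv_into_f)
  qed
  ultimately have "lift_on f b D h"
    by (auto simp: lift_on_def)
  then show thesis
    using that[of "s + e" h] e(1) by (simp add: D_def)
qed

text \<open>The times up to which a lift exists form an interval containing 0. Uniqueness glues the
  lifts below its supremum, and \<open>ext\<close> with \<open>lift_extend\<close> carries the
  result past it.\<close>

theorem lift_exists:
  assumes f: "continuous_map (top_of_set {0..1}) H f"
    and b: "b \<in> topspace T" "q b = f 0"
    and ext: "\<And>s g. s \<in> {0<..1} \<Longrightarrow> lift_on f b {0..<s} g \<Longrightarrow>
      \<exists>U p a. openin T U \<and> inj_on q U \<and> p \<in> U \<and> q p = f s \<and> a < s \<and> g ` ({0..<s} \<inter> {a<..}) \<subseteq> U"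
  obtains g where "lift_on f b {0..1} g"
proof -
  define L where "L = {r \<in> {0..1}. \<exists>g. lift_on f b {0..r} g}"
  define G where "G r = (SOME g. lift_on f b {0..r} g)" for r
  have G: "lift_on f b {0..r} (G r)" if "r \<in> L" for r
    using that unfolding G_def L_def by (metis (mono_tags, lifting) mem_Collect_eq someI_ex)
  have down: "r' \<in> L" if "r \<in> L" "0 \<le> r'" "r' \<le> r" for r r'
    using that lift_on_subset[of f b "{0..r}" _ "{0..r'}"] by (auto simp: L_def)
  have G_eq: "G r t = G r' t" if "r \<in> L" "r' \<in> L" "t \<in> {0..r}" "t \<in> {0..r'}" for r r' t
  proof -
    have 1: "lift_on f b {0..t} (G r)" "lift_on f b {0..t} (G r')"
      using that lift_on_subset[OF G[OF that(1)]] lift_on_subset[OF G[OF that(2)]] by auto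
    have "connected_space (top_of_set {0..t})"
      using connectedin_iff_connected[of "{0..t}"] by (simp add: connectedin_def)
    then show ?thesis
      by (rule lift_unique[where a = 0]) (use 1 that in \<open>auto simp: lift_on_def\<close>)
  qed
  have "0 \<in> L"
  proof -
    have "lift_on f b {0..0} (\<lambda>_. b)"
      using b by (simp add: lift_on_def)
    then show ?thesis
      unfolding L_def by auto
  qed
  define s where "s = Sup L"
  have L_sub: "L \<subseteq> {0..1}" by (auto simp: L_def)
  then have bdd: "bdd_above L" by (meson bdd_above_Icc bdd_above_mono)
  have s: "s \<in> {0..1}"
    using cSup_upper[OF \<open>0 \<in> L\<close> bdd] cSup_least[of L 1] \<open>0 \<in> L\<close> L_sub
    by (force simp: s_def)
  have below: "r \<in> L" if "0 \<le> r" "r < s" for r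
  proof -
    obtain r' where "r' \<in> L" "r < r'"
      using \<open>r < s\<close> less_cSupD[of L r] \<open>0 \<in> L\<close> by (auto simp: s_def)
    with \<open>0 \<le> r\<close> down show ?thesis by auto
  qed
  \<comment> \<open>By \<open>G_eq\<close> the diagonal agrees with every chosen lift that reaches
    beyond \<open>t\<close>.\<close>
  define g where "g t = G t t" for t
  have g: "lift_on f b {0..<s} g"
  proof -
    have gG: "g t = G r t" if "0 \<le> t" "t \<le> r" "r < s" for t r
      unfolding g_def using that below by (intro G_eq) auto
    have "continuous_map (top_of_set {0..<s}) T g"
    proof (rule pasting_lemma[where I = "{0..<s}" and T = "\<lambda>r. {0..<s} \<inter> {..<r}" and f = G])
      show "openin (top_of_set {0..<s}) ({0..<s} \<inter> {..<r})" for r by auto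
      show "continuous_map (subtopology (top_of_set {0..<s}) ({0..<s} \<inter> {..<r})) T (G r)"
        if "r \<in> {0..<s}" for r
      proof -
        have "{0..<s} \<inter> {..<r} \<subseteq> {0..r}" by auto
        then show ?thesis
          using G[OF below[of r]] that lift_on_subset[of f b "{0..r}" "G r"]
          by (auto simp: subtopology_subtopology lift_on_def)
      qed
      show "G r t = G r' t"
        if "r \<in> {0..<s}" "r' \<in> {0..<s}" "t \<in> topspace (top_of_set {0..<s}) \<inter> ({0..<s} \<inter> {..<r}) \<inter> ({0..<s} \<inter> {..<r'})" for r r' t
        using that below by (intro G_eq) auto
      \<comment> \<open>A time strictly between \<open>t\<close> and \<open>s\<close> is needed
        since the pieces \<open>{..<r}\<close> are open; the midpoint serves.\<close>
      show "\<exists>r. r \<in> {0..<s} \<and> t \<in> {0..<s} \<inter> {..<r} \<and> g t = G r t"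
        if "t \<in> topspace (top_of_set {0..<s})" for t
        using that gG[of t "(t + s) / 2"] by (intro exI[of _ "(t + s) / 2"]) auto
    qed
    moreover have "q (g t) = f t" "t = 0 \<longrightarrow> g t = b" if "t \<in> {0..<s}" for t
      using that G[OF below[of t]] unfolding g_def lift_on_def by auto
    ultimately show ?thesis
      by (auto simp: lift_on_def)
  qed
  have "\<exists>U p a. openin T U \<and> inj_on q U \<and> p \<in> U \<and> q p = f s \<and> (s = 0 \<longrightarrow> p = b) \<and> a < s \<and>
    g ` ({0..<s} \<inter> {a<..}) \<subseteq> U"
  proof (cases "s = 0")
    case True
    \<comment> \<open>At \<open>s = 0\<close> nothing has been lifted yet, so the containment in
      \<open>U\<close> is vacuous and any negative \<open>a\<close> works.\<close>
    obtain U where "openin T U" "b \<in> U" "inj_on q U" using locally_inj b by blast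
    then show ?thesis
      using True b(2) by (intro exI[of _ U] exI[of _ b] exI[of _ "-1"]) simp
  next
    case False
    then have "s \<in> {0<..1}" using s by auto
    from ext[OF this g] False show ?thesis by blast
  qed
  then obtain U p a where U: "openin T U" "inj_on q U" "p \<in> U" "q p = f s" "s = 0 \<Longrightarrow> p = b"
    and a: "a < s" "g ` ({0..<s} \<inter> {a<..}) \<subseteq> U"
    by blast
  obtain d h where d: "s < d" and h: "lift_on f b ({0..1} \<inter> {..<d}) h"
    by (rule lift_extend[OF f s g U a])
  have "s = 1"
  proof (rule ccontr)
    assume "s \<noteq> 1"
    then have "s < 1" using s by auto
    \<comment> \<open>A point beyond \<open>s\<close> but still in the unit interval and below
      \<open>d\<close>; it would belong to \<open>L\<close>.\<close>
    define r where "r = min 1 ((s + d) / 2)"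
    have r: "s < r" "r < d" "r \<in> {0..1}" using d \<open>s < 1\<close> s by (auto simp: r_def min_def)
    then have "lift_on f b {0..r} h" using lift_on_subset[OF h, of "{0..r}"] by force
    with r have "r \<in> L" by (auto simp: L_def)
    then show False using cSup_upper[OF _ bdd, of r] r(1) by (simp add: s_def)
  qed
  then have "lift_on f b {0..1} h" using d lift_on_subset[OF h, of "{0..1}"] by force
  then show thesis by (rule that)
qed

end


section \<open>The charts of the graph\<close>

text \<open>Assigns a point to the nearer end of its edge. The choice at the midpoint is harmless:
  for an edge whose middle belongs to the stars considered below, both ends lie in the set of
  vertices or neither does.\<close>

fun home :: "point \<Rightarrow> word" where
  "home (Vertex v) = v"
| "home (Inner e t) = (if t \<le> 1/2 then src e else tgt e)"

lemma edge_param_eq_Vertex_iff: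
  "edge_param e t = Vertex v \<longleftrightarrow> t = 0 \<and> src e = v \<or> t = 1 \<and> tgt e = v"
  by (auto simp: edge_param_def)

lemma edge_param_eq_Inner_iff: "edge_param e t = Inner e' t' \<longleftrightarrow> e = e' \<and> t = t' \<and> t \<noteq> 0 \<and> t \<noteq> 1"
  by (auto simp: edge_param_def)

lemma U_edge_eq: "U_edge e = Inner e ` {1/4<..<3/4}"
  unfolding U_edge_def by (rule image_cong) (auto simp: edge_param_def)

lemma q_map_image_Inner: "q_map ` Inner e ` S = circle_param (lab e) ` S"
  by (simp add: image_image)

section \<open>Edges, points and stars of the graph\<close>

context word_list
begin

lemma edge_cases:
  assumes "e \<in> edges w"
  obtains (arrow) "src e \<in> T" "tgt e \<in> T" "1 \<le> lab e" "tgt e = arrow (src e) (lab e)" "src e \<noteq> tgt e"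
      "lab e \<in> E_labels w (src e)" "lab e \<in> E_labels w (tgt e)"
  | (loop) "src e \<in> T" "1 \<le> lab e" "tgt e = src e" "lab e \<notin> E_labels w (src e)"
proof -
  from assms consider u i where "e = (u, i, arrow u i)" "1 \<le> i" "u \<in> T" "arrow u i \<in> T"
    | v i where "e = (v, i, v)" "1 \<le> i" "v \<in> T" "i \<notin> E_labels w v"
    unfolding edges_def by blast
  then show thesis
  proof cases
    case (1 u i)
    have "arrow u i = step u (i, True)"
      using 1 tree_star_reduced arrow_eq_step by blast
    moreover from this have "i \<in> E_labels w u"
      using E_labels_iff[of u i True] 1 by simp
    moreover have "i \<in> E_labels w (arrow u i)"
      using 1 by (auto simp: E_labels_def)
    ultimately show thesis
      using 1 by (intro that(1)) (auto simp: src_def lab_def tgt_def)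
  next
    case (2 v i)
    then show thesis by (intro that(2)) (auto simp: src_def lab_def tgt_def)
  qed
qed

lemma edge_ends:
  assumes "e \<in> edges w"
  shows "src e \<in> T" "tgt e \<in> T" "1 \<le> lab e"
  using assms by (cases rule: edge_cases; simp)+

text \<open>An edge that is not a loop has its label in \<open>E_labels\<close> at both
  ends.\<close>

lemma loop_if_label_large:
  assumes "e \<in> edges w" "v \<in> {src e, tgt e}" "lab e \<notin> E_labels w v"
  shows "src e = v" "tgt e = v"
  using assms(2,3) by (cases rule: edge_cases[OF assms(1)]; auto)+

lemma edge_eqI: "src e = src e' \<Longrightarrow> lab e = lab e' \<Longrightarrow> tgt e = tgt e' \<Longrightarrow> e = e'"
  by (simp add: src_def lab_def tgt_def prod_eq_iff)

text \<open>Together with \<open>edge_unique_tgt\<close>, \<open>edge_from\<close> and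
  \<open>edge_to\<close>: each label leaves and enters each vertex exactly once. Bijectivity of
  \<open>q_map\<close> on stars comes from this.\<close>

lemma edge_unique_src:
  assumes "e \<in> edges w" "e' \<in> edges w" "src e = src e'" "lab e = lab e'"
  shows "e = e'"
  using assms(3,4)
  by (cases rule: edge_cases[OF assms(1)]; cases rule: edge_cases[OF assms(2)]) (auto intro: edge_eqI)

lemma edge_unique_tgt:
  assumes "e \<in> edges w" "e' \<in> edges w" "tgt e = tgt e'" "lab e = lab e'"
  shows "e = e'"
proof -
  have "u = u'" if "u \<in> T" "u' \<in> T" "arrow u i = arrow u' i" for u u' i
    using that tree_star_reduced arrow_eq_step step_Not[of u i True] step_Not[of u' i True] by metis
  from this[of "src e" "src e'" "lab e"] have "src e = src e'"
    using assms(3,4)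
    by (cases rule: edge_cases[OF assms(1)]; cases rule: edge_cases[OF assms(2)]) auto
  with assms show ?thesis by (auto intro: edge_eqI)
qed

lemma edge_from:
  assumes "v \<in> T" "1 \<le> i"
  obtains e where "e \<in> edges w" "src e = v" "lab e = i"
proof (cases "i \<in> E_labels w v")
  case True
  then have "arrow v i \<in> T"
    using assms(1) E_labels_iff[of v i True] arrow_eq_step tree_star_reduced by simp
  with assms show thesis
    by (intro that[of "(v, i, arrow v i)"]) (auto simp: edges_def src_def lab_def)
next
  case False
  with assms show thesis
    by (intro that[of "(v, i, v)"]) (auto simp: edges_def src_def lab_def)
qed

lemma edge_to:
  assumes "v \<in> T" "1 \<le> i"
  obtains e where "e \<in> edges w" "tgt e = v" "lab e = i"
proof (cases "i \<in> E_labels w v")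
  case True
  then obtain u where "u \<in> T" "arrow u i = v" by (auto simp: E_labels_def)
  with assms show thesis
    by (intro that[of "(u, i, v)"]) (auto simp: edges_def tgt_def lab_def)
next
  case False
  with assms show thesis
    by (intro that[of "(v, i, v)"]) (auto simp: edges_def tgt_def lab_def)
qed

lemma Inner_in_H_hat: "e \<in> edges w \<Longrightarrow> t \<in> {0<..<1} \<Longrightarrow> Inner e t \<in> H_hat w"
  unfolding H_hat_def by (auto simp: edge_param_def image_iff intro!: bexI[of _ e] bexI[of _ t])

lemma Vertex_in_H_hat: "Vertex v \<in> H_hat w \<longleftrightarrow> v \<in> T"
  unfolding H_hat_def by (auto simp: edge_param_eq_Vertex_iff[THEN eq_commute[THEN iffD1]] edge_ends edge_param_def split: if_splits)

lemma H_hat_cases: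
  assumes "x \<in> H_hat w"
  obtains v where "v \<in> T" "x = Vertex v"
  | e t where "e \<in> edges w" "t \<in> {0<..<1}" "x = Inner e t"
proof -
  from assms consider v where "v \<in> T" "x = Vertex v"
    | e t where "e \<in> edges w" "t \<in> {0..1}" "x = edge_param e t"
    unfolding H_hat_def by blast
  then show thesis
  proof cases
    case (2 e t)
    then show thesis
      using that edge_ends[of e] by (cases "t = 0 \<or> t = 1") (auto simp: edge_param_def)
  qed (use that in auto)
qed

lemma q_map_Inner_neq_0:
  assumes "e \<in> edges w" "t \<in> {0<..<1}"
  shows "q_map (Inner e t) \<noteq> (0, 0)"
  using circle_param_neq_0[of "lab e" t] edge_ends(3)[OF assms(1)] assms(2) by simp

lemma q_map_Inner_eq_iff:
  assumes "e \<in> edges w" "t \<in> {0<..<1}" "e' \<in> edges w" "t' \<in> {0<..<1}"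
  shows "q_map (Inner e t) = q_map (Inner e' t') \<longleftrightarrow> lab e = lab e' \<and> t = t'"
  using circle_param_inject[of "lab e" t "lab e'" t'] edge_ends(3) assms by simp

text \<open>Generalizes the charts \<open>U_vertex\<close> to sets of vertices and to arbitrary
  bounds. The lift is trapped in stars of larger sets before it is trapped in that of one
  vertex.\<close>

definition star :: "nat \<Rightarrow> word set \<Rightarrow> point set" where
  "star m C = {x \<in> H_hat w. q_map x \<in> U_inf m \<and> home x \<in> C}"

lemma Inner_in_star_iff:
  assumes "e \<in> edges w" "t \<in> {0<..<1}" "1 \<le> m"
  shows "Inner e t \<in> star m C \<longleftrightarrow> (m \<le> lab e \<or> t < 3/8 \<or> 5/8 < t) \<and> home (Inner e t) \<in> C"
  using circle_param_in_U_inf_iff[OF assms(3) edge_ends(3)[OF assms(1)] assms(2)]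
    Inner_in_H_hat[OF assms(1,2)] by (auto simp: star_def)

lemma Vertex_in_star_iff: "1 \<le> m \<Longrightarrow> Vertex v \<in> star m C \<longleftrightarrow> v \<in> T \<and> v \<in> C"
  using zero_in_U_inf by (auto simp: star_def Vertex_in_H_hat)

lemma Inner_in_U_vertex_iff:
  assumes "e \<in> edges w" "t \<in> {0<..<1}"
  shows "Inner e t \<in> U_vertex w v \<longleftrightarrow> src e = v \<and> t < 3/8 \<or> tgt e = v \<and> 5/8 < t \<or>
    src e = v \<and> tgt e = v \<and> n_vertex w v < lab e"
proof -
  have "Inner e t \<in> edge_param e' ` S \<longleftrightarrow> e = e' \<and> t \<in> S" for e' S
    using assms(2) edge_param_eq_Inner_iff[of e' _ e t] by (auto simp: image_iff eq_commute[of "Inner e t"])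
  then show ?thesis
    using assms by (auto simp: U_vertex_def)
qed

lemma Vertex_in_U_vertex_iff:
  assumes "v \<in> T"
  shows "Vertex v' \<in> U_vertex w v \<longleftrightarrow> v' = v"
proof
  show "v' = v" if "Vertex v' \<in> U_vertex w v"
  proof -
    from that obtain e t where "Vertex v' = edge_param e t" "src e = v \<and> t < 3/8 \<or> tgt e = v \<and> 5/8 < t \<or> src e = v \<and> tgt e = v"
      unfolding U_vertex_def by fastforce
    then show ?thesis
      using edge_param_eq_Vertex_iff[of e t v'] by auto
  qed
  show "Vertex v' \<in> U_vertex w v" if "v' = v"
  proof -
    obtain e where e: "e \<in> edges w" "src e = v" by (rule edge_from[OF assms order.refl])
    then have "Vertex v \<in> edge_param e ` {0..<3/8}"
      by (auto simp: edge_param_def intro!: image_eqI[of _ _ 0])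
    with e that show ?thesis unfolding U_vertex_def by blast
  qed
qed

lemma U_vertex_subset_H_hat: "U_vertex w v \<subseteq> H_hat w"
  unfolding U_vertex_def H_hat_def by fastforce

text \<open>Beyond \<open>n_vertex w v\<close> every edge at \<open>v\<close> is a loop, so the
  entire loops in the chart are exactly the circles contained whole in \<open>U_inf\<close>.\<close>

lemma U_vertex_eq_star:
  assumes v: "v \<in> T"
  shows "U_vertex w v = star (n_vertex w v + 1) {v}"
proof -
  have "x \<in> U_vertex w v \<longleftrightarrow> x \<in> star (n_vertex w v + 1) {v}" if "x \<in> H_hat w" for x
    using that
  proof (cases rule: H_hat_cases)
    case (1 v')
    then show ?thesis using v by (auto simp: Vertex_in_U_vertex_iff Vertex_in_star_iff)
  next
    case (2 e t)
    have "src e = v \<and> tgt e = v" if "v \<in> {src e, tgt e}" "n_vertex w v < lab e"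
    proof -
      have "lab e \<notin> E_labels w v" using n_vertex(2)[OF v] that(2) by auto
      with loop_if_label_large[OF 2(1) that(1)] show ?thesis by simp
    qed
    with 2 show ?thesis
      by (auto simp: Inner_in_U_vertex_iff Inner_in_star_iff)
  qed
  then show ?thesis
    using U_vertex_subset_H_hat by (auto simp: star_def)
qed

text \<open>The image of an inner point determines its label and time. The time tells whether
  \<open>v\<close> is the source or the target, and then the label fixes the edge.\<close>

lemma inj_on_star: "inj_on q_map (star m {v})"
proof (rule inj_onI)
  fix x y assume xy: "x \<in> star m {v}" "y \<in> star m {v}" "q_map x = q_map y"
  then have H: "x \<in> H_hat w" "y \<in> H_hat w" "home x = v" "home y = v"
    by (auto simp: star_def)
  from H(1) show "x = y"
  proof (cases rule: H_hat_cases)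
    case x: (1 u)
    from H(2) show ?thesis
    proof (cases rule: H_hat_cases)
      case (2 e t)
      with x xy(3) show ?thesis using q_map_Inner_neq_0[of e t] by simp
    qed (use x H in simp)
  next
    case x: (2 e t)
    from H(2) show ?thesis
    proof (cases rule: H_hat_cases)
      case (1 u)
      with x xy(3) show ?thesis using q_map_Inner_neq_0[of e t] by simp
    next
      case (2 e' t')
      with x xy(3) have "lab e = lab e'" "t = t'"
        using q_map_Inner_eq_iff by blast+
      with x 2 H(3,4) show ?thesis
        using edge_unique_src[of e e'] edge_unique_tgt[of e e'] by (auto split: if_splits)
    qed
  qed
qed

lemma q_map_image_star:
  assumes v: "v \<in> T" and m: "1 \<le> m"
  shows "q_map ` star m {v} = U_inf m"
proof
  show "U_inf m \<subseteq> q_map ` star m {v}"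
  proof
    fix p assume p: "p \<in> U_inf m"
    then have "p \<in> hawaiian" using U_inf_subset[OF m] by auto
    then show "p \<in> q_map ` star m {v}"
    proof (cases rule: hawaiian_cases)
      case 1
      then show ?thesis
        using v m by (auto simp: Vertex_in_star_iff intro!: image_eqI[of _ _ "Vertex v"])
    next
      case (2 i t)
      obtain e where e: "e \<in> edges w" "lab e = i" "home (Inner e t) = v"
      proof (cases "t \<le> 1/2")
        case True
        obtain e where "e \<in> edges w" "src e = v" "lab e = i" by (rule edge_from[OF v 2(1)])
        with True that[of e] show thesis by simp
      next
        case False
        obtain e where "e \<in> edges w" "tgt e = v" "lab e = i" by (rule edge_to[OF v 2(1)])
        with False that[of e] show thesis by simp
      qed
      then have "Inner e t \<in> star m {v}"
        using p 2 Inner_in_H_hat[OF e(1)] by (auto simp: star_def)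
      with e 2 show ?thesis by (intro image_eqI[of _ _ "Inner e t"]) auto
    qed
  qed
qed (auto simp: star_def)

text \<open>If no edge with label at least \<open>m\<close> joins \<open>C\<close> to its
  complement, the boundary of the star of \<open>C\<close> lies over middle arcs omitted from
  \<open>U_inf m\<close>, so the stars of \<open>C\<close> and of its complement are both
  open.\<close>

definition crossed :: "nat \<Rightarrow> word set \<Rightarrow> bool" where
  "crossed m C \<longleftrightarrow> (\<exists>e\<in>edges w. m \<le> lab e \<and> (src e \<in> C) \<noteq> (tgt e \<in> C))"

lemma not_crossed_singleton:
  assumes "E_labels w v \<subseteq> {1..<m}"
  shows "\<not> crossed m {v}"
proof -
  have "src e = v \<longleftrightarrow> tgt e = v" if "e \<in> edges w" "m \<le> lab e" for e
  proof -
    have "lab e \<notin> E_labels w v" using assms that(2) by auto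
    then show ?thesis using loop_if_label_large[OF that(1), of v] by auto
  qed
  then show ?thesis by (auto simp: crossed_def)
qed

lemma not_crossed_Diff: "\<not> crossed m C \<Longrightarrow> \<not> crossed m (T - C)"
  using edge_ends by (auto simp: crossed_def)

lemma star_Int_edge:
  assumes e: "e \<in> edges w" and S: "open S" "S \<subseteq> {0<..<1}" and m: "1 \<le> m" and C: "\<not> crossed m C"
  shows "openin (top_of_set hawaiian) (q_map ` (star m C \<inter> Inner e ` S))"
proof -
  \<comment> \<open>The times at which \<open>e\<close> runs in the star. For a label at least
    \<open>m\<close> this is all or nothing since \<open>C\<close> is not crossed; for smaller
    labels the middle arc is missing, so the switch of \<open>home\<close> at 1/2 is
    invisible.\<close>
  define R :: "real set" where "R = (if m \<le> lab e then {t. src e \<in> C} else {t. t < 3/8 \<and> src e \<in> C \<or> 5/8 < t \<and> tgt e \<in> C})"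
  have "Inner e t \<in> star m C \<longleftrightarrow> t \<in> R" if "t \<in> S" for t
  proof -
    have "t \<in> {0<..<1}" using that S(2) by blast
    from Inner_in_star_iff[OF e this m] show ?thesis
      using e C by (auto simp: R_def crossed_def)
  qed
  then have "star m C \<inter> Inner e ` S = Inner e ` (S \<inter> R)" by auto
  moreover have "open R"
    unfolding R_def by (auto intro!: open_Collect_conj open_Collect_disj open_Collect_less continuous_intros)
  ultimately show ?thesis
    using open_circle_param_image[of "S \<inter> R" "lab e"] S edge_ends(3)[OF e]
    by (simp add: q_map_image_Inner open_Int le_infI1)
qed

lemma U_vertex_not_crossed: "v \<in> T \<Longrightarrow> \<not> crossed (n_vertex w v + 1) {v}"
  using n_vertex(2)[of v] by (intro not_crossed_singleton) force

section \<open>The topology glued from the edge and vertex charts\<close>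

abbreviation \<U> :: "point set set" where "\<U> \<equiv> U_edge ` edges w \<union> U_vertex w ` T"

lemma U_edge_Int_U_vertex:
  assumes "e \<in> edges w" "v \<in> T"
  shows "openin (top_of_set hawaiian) (q_map ` (U_edge e \<inter> U_vertex w v))"
  using star_Int_edge[OF assms(1), of "{1/4<..<3/4}" "n_vertex w v + 1" "{v}"] U_vertex_not_crossed assms(2)
  by (simp add: U_edge_eq U_vertex_eq_star Int_commute subset_eq)

lemma openin_image_Inner:
  assumes "e \<in> edges w" "open S" "S \<subseteq> {0<..<1}"
  shows "openin (top_of_set hawaiian) (q_map ` Inner e ` S)"
  unfolding q_map_image_Inner using open_circle_param_image assms edge_ends(3) by blast

lemma U_vertex_disjoint: "u \<in> T \<Longrightarrow> v \<in> T \<Longrightarrow> u \<noteq> v \<Longrightarrow> U_vertex w u \<inter> U_vertex w v = {}"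
  by (auto simp: U_vertex_eq_star star_def)

sublocale charts "H_hat w" "top_of_set hawaiian" q_map \<U>
proof
  show "\<Union>\<U> = H_hat w"
  proof (intro equalityI subsetI)
    fix x assume "x \<in> \<Union>\<U>"
    then show "x \<in> H_hat w"
      using U_vertex_subset_H_hat Inner_in_H_hat by (auto simp: U_edge_eq)
  next
    fix x assume "x \<in> H_hat w"
    then show "x \<in> \<Union>\<U>"
    proof (cases rule: H_hat_cases)
      case (1 v)
      then have "x \<in> U_vertex w v" using Vertex_in_U_vertex_iff by simp
      with 1 show ?thesis by blast
    next
      case (2 e t)
      have "x \<in> U_edge e \<or> x \<in> U_vertex w (src e) \<or> x \<in> U_vertex w (tgt e)"
        using 2 by (cases "t < 3/8"; cases "5/8 < t") (auto simp: U_edge_eq Inner_in_U_vertex_iff)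
      with 2 edge_ends[of e] show ?thesis by blast
    qed
  qed
next
  fix U assume "U \<in> \<U>"
  then consider e where "e \<in> edges w" "U = U_edge e" | v where "v \<in> T" "U = U_vertex w v" by blast
  then show "inj_on q_map U"
  proof cases
    case (1 e)
    then show ?thesis
      using q_map_Inner_eq_iff[of e _ e] by (auto simp: U_edge_eq inj_on_def)
  qed (simp add: U_vertex_eq_star inj_on_star)
next
  fix U V assume "U \<in> \<U>" "V \<in> \<U>"
  then consider e e' where "e \<in> edges w" "e' \<in> edges w" "U = U_edge e" "V = U_edge e'"
    | e v where "e \<in> edges w" "v \<in> T" "U = U_edge e" "V = U_vertex w v"
    | e v where "e \<in> edges w" "v \<in> T" "U = U_vertex w v" "V = U_edge e"
    | u v where "u \<in> T" "v \<in> T" "U = U_vertex w u" "V = U_vertex w v"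
    by blast
  \<comment> \<open>Distinct charts of the same kind are disjoint, so only an edge chart and a
    vertex chart overlap properly.\<close>
  then show "openin (top_of_set hawaiian) (q_map ` (U \<inter> V))"
  proof cases
    case (1 e e')
    have "U \<inter> V = (if e = e' then U_edge e else {})"
      using 1 by (auto simp: U_edge_eq)
    then show ?thesis
      using openin_image_Inner[OF 1(1), of "{1/4<..<3/4}"] by (auto simp: U_edge_eq subset_eq)
  next
    case (2 e v)
    then show ?thesis using U_edge_Int_U_vertex by simp
  next
    case (3 e v)
    then show ?thesis using U_edge_Int_U_vertex by (simp add: Int_commute)
  next
    case (4 u v)
    have "U \<inter> V = (if u = v then U_vertex w u else {})"
      using 4 U_vertex_disjoint by auto
    moreover have "openin (top_of_set hawaiian) (q_map ` U_vertex w u)"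
      using openin_U_inf[of "n_vertex w u + 1"]
      by (simp add: U_vertex_eq_star[OF 4(1)] q_map_image_star[OF 4(1)])
    ultimately show ?thesis by (cases "u = v") simp_all
  qed
qed

text \<open>The glued topology has the properties demanded by the definite description and is the
  only one that has them.\<close>

lemma H_hat_topology_eq: "H_hat_topology w = chart_topology"
proof -
  let ?P = "\<lambda>T'. topspace T' = H_hat w \<and>
     (\<forall>e\<in>edges w. openin T' (U_edge e) \<and>
        homeomorphic_map (subtopology T' (U_edge e)) (top_of_set (U_arc (lab e))) q_map) \<and>
     (\<forall>v\<in>tree_star w. openin T' (U_vertex w v) \<and>
        homeomorphic_map (subtopology T' (U_vertex w v)) (top_of_set (U_inf (n_vertex w v + 1))) q_map)"
  have arc: "subtopology (top_of_set hawaiian) (q_map ` U_edge e) = top_of_set (U_arc (lab e))"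
    if "e \<in> edges w" for e
    using U_arc_subset_hawaiian[OF edge_ends(3)[OF that]]
    by (simp add: subtopology_subtopology U_edge_eq q_map_image_Inner U_arc_def Int_absorb1)
  have inf: "subtopology (top_of_set hawaiian) (q_map ` U_vertex w v) = top_of_set (U_inf (n_vertex w v + 1))"
    if "v \<in> T" for v
    using U_inf_subset[of "n_vertex w v + 1"] q_map_image_star[OF that, of "n_vertex w v + 1"]
    by (simp add: subtopology_subtopology U_vertex_eq_star[OF that] Int_absorb1)
  show ?thesis
    unfolding H_hat_topology_def
  proof (rule the_equality)
    show "?P chart_topology"
    proof (intro conjI ballI)
      fix e assume e: "e \<in> edges w"
      then have "U_edge e \<in> \<U>" by blast
      from openin_chart[OF this] homeomorphic_map_chart[OF this]
      show "openin chart_topology (U_edge e)"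
        "homeomorphic_map (subtopology chart_topology (U_edge e)) (top_of_set (U_arc (lab e))) q_map"
        unfolding arc[OF e] by blast+
    next
      fix v assume v: "v \<in> T"
      then have "U_vertex w v \<in> \<U>" by blast
      from openin_chart[OF this] homeomorphic_map_chart[OF this]
      show "openin chart_topology (U_vertex w v)"
        "homeomorphic_map (subtopology chart_topology (U_vertex w v)) (top_of_set (U_inf (n_vertex w v + 1))) q_map"
        unfolding inf[OF v] by blast+
    qed simp
  next
    fix T' assume P: "?P T'"
    have "openin T' U \<and>
        homeomorphic_map (subtopology T' U) (subtopology (top_of_set hawaiian) (q_map ` U)) q_map"
      if "U \<in> \<U>" for U
    proof -
      from that consider e where "e \<in> edges w" "U = U_edge e" | v where "v \<in> T" "U = U_vertex w v" by blast
      then show ?thesis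
      proof cases
        case (1 e)
        with P show ?thesis unfolding 1(2) arc[OF 1(1)] by blast
      next
        case (2 v)
        with P show ?thesis unfolding 2(2) inf[OF 2(1)] by blast
      qed
    qed
    then show "T' = chart_topology"
      using P by (intro chart_topology_unique) auto
  qed
qed

lemma openin_star:
  assumes m: "1 \<le> m" and C: "\<not> crossed m C"
  shows "openin chart_topology (star m C)"
  unfolding openin_chart_topology
proof (intro conjI ballI)
  show "star m C \<subseteq> H_hat w" by (auto simp: star_def)
  fix U assume "U \<in> \<U>"
  then consider e where "e \<in> edges w" "U = U_edge e" | v where "v \<in> T" "U = U_vertex w v" by blast
  then show "openin (top_of_set hawaiian) (q_map ` (star m C \<inter> U))"
  proof cases
    case (1 e)
    then show ?thesis
      using star_Int_edge[OF 1(1) _ _ m C, of "{1/4<..<3/4}"] by (simp add: U_edge_eq subset_eq)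
  next
    case (2 v)
    \<comment> \<open>The sets \<open>U_inf\<close> decrease with their index, so the intersection
      of two is the one with the larger index; the star meets the chart at \<open>v\<close> in a
      smaller star of \<open>v\<close>, or not at all.\<close>
    define n where "n = max m (n_vertex w v + 1)"
    have "U_inf m \<inter> U_inf (n_vertex w v + 1) = U_inf n"
      using U_inf_antimono[OF m, of "n_vertex w v + 1"] U_inf_antimono[of "n_vertex w v + 1" m]
      by (auto simp: n_def max_def)
    then have "star m C \<inter> U = (if v \<in> C then star n {v} else {})"
      using 2 by (auto simp: U_vertex_eq_star star_def)
    moreover have "1 \<le> n" using m by (simp add: n_def)
    ultimately show ?thesis
      using q_map_image_star[OF 2(1)] openin_U_inf by simp
  qed
qed

text \<open>An edge chart covers only the middle half of its edge. The full open edge is needed to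
  separate fibres and to trap a lift away from the base point.\<close>

lemma openin_edge_interior:
  assumes e: "e \<in> edges w"
  shows "openin chart_topology (Inner e ` {0<..<1})"
  unfolding openin_chart_topology
proof (intro conjI ballI)
  show "Inner e ` {0<..<1} \<subseteq> H_hat w" using Inner_in_H_hat[OF e] by blast
  fix U assume "U \<in> \<U>"
  then consider e' where "e' \<in> edges w" "U = U_edge e'" | v where "v \<in> T" "U = U_vertex w v" by blast
  then show "openin (top_of_set hawaiian) (q_map ` (Inner e ` {0<..<1} \<inter> U))"
  proof cases
    case (1 e')
    then have "Inner e ` {0<..<1} \<inter> U = (if e = e' then Inner e ` {1/4<..<3/4} else {})"
      by (auto simp: U_edge_eq)
    then show ?thesis
      using openin_image_Inner[OF e, of "{1/4<..<3/4}"] by (auto simp: subset_eq)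
  next
    case (2 v)
    then show ?thesis
      using star_Int_edge[OF e, of "{0<..<1}" "n_vertex w v + 1" "{v}"] U_vertex_not_crossed
      by (simp add: U_vertex_eq_star Int_commute)
  qed
qed

text \<open>A fibre consists either of vertices, separated by their disjoint charts, or of inner
  points on different edges, separated by the disjoint edge interiors.\<close>

sublocale local_homeo chart_topology "top_of_set hawaiian" q_map
proof
  show "continuous_map chart_topology (top_of_set hawaiian) q_map"
    by (rule continuous_map_chart_topology)
  show "open_map chart_topology (top_of_set hawaiian) q_map"
    by (rule open_map_chart_topology)
  show "\<exists>U. openin chart_topology U \<and> x \<in> U \<and> inj_on q_map U" if "x \<in> topspace chart_topology" for x
  proof -
    have "x \<in> \<Union>\<U>" using that unfolding cover topspace_chart_topology .
    then obtain U where "U \<in> \<U>" "x \<in> U" by (rule UnionE)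
    with openin_chart inj_chart show ?thesis by (intro exI[of _ U] conjI)
  qed
  show "\<exists>U V. openin chart_topology U \<and> openin chart_topology V \<and> x \<in> U \<and> y \<in> V \<and> U \<inter> V = {}"
    if xy: "x \<in> topspace chart_topology" "y \<in> topspace chart_topology" "x \<noteq> y" "q_map x = q_map y" for x y
  proof -
    have x: "x \<in> H_hat w" and y: "y \<in> H_hat w" using xy by auto
    from x show ?thesis
    proof (cases rule: H_hat_cases)
      case u: (1 u)
      from y show ?thesis
      proof (cases rule: H_hat_cases)
        case v: (1 v)
        then have "u \<noteq> v" using u xy(3) by auto
        with u v show ?thesis
          using U_vertex_disjoint[of u v] openin_chart[of "U_vertex w u"] openin_chart[of "U_vertex w v"]
            Vertex_in_U_vertex_iff
          by (intro exI[of _ "U_vertex w u"] exI[of _ "U_vertex w v"]) simp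
      next
        case (2 e t)
        with u xy(4) show ?thesis using q_map_Inner_neq_0[of e t] by simp
      qed
    next
      case e: (2 e t)
      from y show ?thesis
      proof (cases rule: H_hat_cases)
        case (1 v)
        with e xy(4) show ?thesis using q_map_Inner_neq_0[of e t] by simp
      next
        case e': (2 e' t')
        then have "e \<noteq> e'"
          using e xy(3,4) q_map_Inner_eq_iff[of e t e' t'] by auto
        then have "Inner e ` {0<..<1} \<inter> Inner e' ` {0<..<1} = {}" by auto
        with e e' show ?thesis
          using openin_edge_interior[of e] openin_edge_interior[of e']
          by (intro exI[of _ "Inner e ` {0<..<1}"] exI[of _ "Inner e' ` {0<..<1}"]) simp
      qed
    qed
  qed
qed

section \<open>Lifting paths\<close>

lemma connectedin_in_side:
  assumes "connectedin X K" "openin X A" "openin X B" "K \<subseteq> A \<union> B" "A \<inter> B = {}" "x \<in> K" "x \<in> A"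
  shows "K \<subseteq> A"
proof (rule ccontr)
  assume "\<not> K \<subseteq> A"
  with assms have "B \<inter> K \<noteq> {}" "A \<inter> K \<noteq> {}" "A \<inter> B \<inter> K = {}" by blast+
  with assms show False unfolding connectedin by blast
qed

text \<open>Take the part of the tree in some \<open>Y j\<close> containing \<open>v\<close>: edges
  with a label of at least 3 do not leave it and all labels at it are at most \<open>N j\<close>. If
  there is no such \<open>Y j\<close>, only labels 1 and 2 occur at \<open>v\<close>, and
  \<open>v\<close> alone suffices.\<close>

lemma not_crossed_component:
  assumes v: "v \<in> T"
  obtains C M where "v \<in> C" "C \<subseteq> T" "\<not> crossed 3 C" "3 \<le> M" "\<And>u. u \<in> C \<Longrightarrow> E_labels w u \<subseteq> {1..<M}"
proof (cases "\<exists>j. v \<in> Y j")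
  case True
  then obtain j where j: "v \<in> Y j" by blast
  have "src e \<in> Y j \<longleftrightarrow> tgt e \<in> Y j" if "e \<in> edges w" "3 \<le> lab e" for e
    using that(1)
  proof (cases rule: edge_cases)
    case arrow
    with that(2) show ?thesis using Y_edge_iff by simp
  qed simp
  then have "\<not> crossed 3 (T \<inter> Y j)"
    using edge_ends by (auto simp: crossed_def)
  moreover have "E_labels w u \<subseteq> {1..<N j + 1}" if "u \<in> T \<inter> Y j" for u
    using E_labels_subset_Y[of u j] that by (auto simp: subset_eq less_Suc_eq_le)
  ultimately show thesis
    using that[of "T \<inter> Y j" "N j + 1"] j v n_of_Suc(1)[of j] by auto
next
  case False
  then have "E_labels w v \<subseteq> {1..<3}"
    using E_labels_subset_not_Y[OF v] by (auto simp: subset_eq)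
  then show thesis
    using that[of "{v}" 3] v not_crossed_singleton by auto
qed

text \<open>A partial lift has to stay inside one chart as it approaches its end point \<open>s\<close>.  If \<open>f s\<close>
  is not the base point, this is the interior of one edge, by connectedness.  If \<open>f s\<close> is the
  base point, then the lift cannot leave the stars of a set \<open>C\<close> of vertices whose edge labels are
  bounded and which no edge with a label at least 3 leaves; once \<open>f\<close> also avoids the
  middle arcs of all circles whose labels occur on the edges at \<open>C\<close>, the lift stays in the star of a single vertex.\<close>

lemma lift_near_end:
  assumes f: "continuous_map (top_of_set {0..1}) (top_of_set hawaiian) f"
    and s: "s \<in> {0<..1}" and g: "lift_on f b {0..<s} g"
  shows "\<exists>U p a. openin chart_topology U \<and> inj_on q_map U \<and> p \<in> U \<and> q_map p = f s \<and> a < s \<and>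
    g ` ({0..<s} \<inter> {a<..}) \<subseteq> U"
proof -
  have near: "\<exists>a. 0 \<le> a \<and> a < s \<and> (\<forall>t\<in>{0..<s} \<inter> {a<..}. q_map (g t) \<in> W)"
    if W: "openin (top_of_set hawaiian) W" "f s \<in> W" for W
  proof -
    have "openin (top_of_set {0..1}) {t \<in> {0..1}. f t \<in> W}"
      using f W(1) by (simp add: continuous_map)
    moreover have "s \<in> {t \<in> {0..1}. f t \<in> W}" using s W(2) by auto
    ultimately obtain e where e: "e > 0" "\<And>t. t \<in> {0..1} \<Longrightarrow> \<bar>t - s\<bar> < e \<Longrightarrow> f t \<in> W"
      unfolding openin_euclidean_subtopology_iff dist_real_def by blast
    have "q_map (g t) \<in> W" if "t \<in> {0..<s} \<inter> {max 0 (s - e)<..}" for t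
      using e(2)[of t] that s g by (auto simp: lift_on_def)
    then show ?thesis
      using e(1) s by (intro exI[of _ "max 0 (s - e)"]) auto
  qed
  have conn: "connectedin chart_topology (g ` ({0..<s} \<inter> {a<..}))" for a
  proof (rule connectedin_continuous_map_image)
    show "continuous_map (top_of_set {0..<s}) chart_topology g"
      using g by (simp add: lift_on_def)
    have "connected ({0..<s} \<inter> {a<..})"
      by (intro convex_connected convex_Int) auto
    then show "connectedin (top_of_set {0..<s}) ({0..<s} \<inter> {a<..})"
      by (simp add: connectedin_subtopology)
  qed
  have in_H: "g t \<in> H_hat w" if "t \<in> {0..<s}" for t
    using that g continuous_map_image_subset_topspace[of "top_of_set {0..<s}" chart_topology g]
    by (auto simp: lift_on_def)
  have "f s \<in> hawaiian"
    using s continuous_map_image_subset_topspace[OF f] by auto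
  then show ?thesis
  proof (cases rule: hawaiian_cases)
    case (2 i \<tau>)
    obtain a where a: "0 \<le> a" "a < s" "\<And>t. t \<in> {0..<s} \<inter> {a<..} \<Longrightarrow> q_map (g t) \<in> circle_param i ` {0<..<1}"
      using near[of "circle_param i ` {0<..<1}"] open_circle_param_image[of "{0<..<1}" i] 2 by auto
    have inner: "\<exists>e t'. e \<in> edges w \<and> lab e = i \<and> t' \<in> {0<..<1} \<and> g t = Inner e t'"
      if t: "t \<in> {0..<s} \<inter> {a<..}" for t
    proof -
      obtain r where r: "r \<in> {0<..<1}" "q_map (g t) = circle_param i r" using a(3)[OF t] by blast
      have "g t \<in> H_hat w" using in_H t by blast
      then show ?thesis
      proof (cases rule: H_hat_cases)
        case (1 v)
        with r 2(1) circle_param_neq_0[of i r] show ?thesis by auto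
      next
        case (2 e t')
        with r circle_param_inject[of "lab e" t' i r] edge_ends(3)[of e] \<open>1 \<le> i\<close>
        have "lab e = i" by simp
        with 2 show ?thesis by blast
      qed
    qed
    define t0 where "t0 = (a + s) / 2"
    have t0: "t0 \<in> {0..<s} \<inter> {a<..}" using a by (auto simp: t0_def)
    then obtain e t' where e: "e \<in> edges w" "lab e = i" "t' \<in> {0<..<1}" "g t0 = Inner e t'"
      using inner by blast
    \<comment> \<open>Near the end the lift runs over \<open>circle i\<close> without its base
      point, hence in the disjoint open edge interiors; connectedness selects one of them.\<close>
    let ?A = "Inner e ` {0<..<1}" and ?B = "\<Union>e'\<in>edges w - {e}. Inner e' ` {0<..<1}"
    have "g ` ({0..<s} \<inter> {a<..}) \<subseteq> ?A"
    proof (rule connectedin_in_side[OF conn])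
      show "openin chart_topology ?A" "openin chart_topology ?B"
        using openin_edge_interior e by auto
      show "g ` ({0..<s} \<inter> {a<..}) \<subseteq> ?A \<union> ?B"
      proof (rule image_subsetI)
        fix t assume "t \<in> {0..<s} \<inter> {a<..}"
        from inner[OF this] obtain e' t' where "e' \<in> edges w" "t' \<in> {0<..<1}" "g t = Inner e' t'"
          by blast
        then show "g t \<in> ?A \<union> ?B" by (cases "e' = e") blast+
      qed
      show "?A \<inter> ?B = {}" by auto
      show "g t0 \<in> g ` ({0..<s} \<inter> {a<..})" using t0 by (rule imageI)
      show "g t0 \<in> ?A" using e by simp
    qed
    moreover have "inj_on q_map ?A"
      using q_map_Inner_eq_iff[OF e(1) _ e(1)] by (auto simp: inj_on_def)
    moreover have "Inner e \<tau> \<in> ?A" "q_map (Inner e \<tau>) = f s" using 2 e by auto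
    ultimately show ?thesis
      using openin_edge_interior[OF e(1)] a(2) by blast
  next
    case 1
    \<comment> \<open>Over \<open>U_inf m\<close> the lift lies in the union of two disjoint open
      stars, those of \<open>C\<close> and of its complement, so its connected image remains in
      one.\<close>
    have stay: "g ` ({0..<s} \<inter> {a<..}) \<subseteq> star m C"
      if m: "1 \<le> m" "\<And>t. t \<in> {0..<s} \<inter> {a<..} \<Longrightarrow> q_map (g t) \<in> U_inf m"
        and C: "\<not> crossed m C" and t: "t \<in> {0..<s} \<inter> {a<..}" "home (g t) \<in> C" for m a C t
    proof (rule connectedin_in_side[OF conn])
      show "openin chart_topology (star m C)" "openin chart_topology (star m (T - C))"
        using openin_star m(1) C not_crossed_Diff by blast+
      have "home x \<in> T" if "x \<in> H_hat w" for x
        using that edge_ends by (cases rule: H_hat_cases) auto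
      then show "g ` ({0..<s} \<inter> {a<..}) \<subseteq> star m C \<union> star m (T - C)"
        using m(2) in_H by (auto simp: star_def)
      show "star m C \<inter> star m (T - C) = {}" by (auto simp: star_def)
      show "g t \<in> g ` ({0..<s} \<inter> {a<..})" "g t \<in> star m C"
        using t m(2) in_H by (auto simp: star_def)
    qed
    \<comment> \<open>First round: only edges with label 1 or 2 can leave the set \<open>C\<close>
      chosen below, and over \<open>U_inf 3\<close> their middle arcs are out of reach.\<close>
    obtain a where a: "0 \<le> a" "a < s" "\<And>t. t \<in> {0..<s} \<inter> {a<..} \<Longrightarrow> q_map (g t) \<in> U_inf 3"
      using near[OF openin_U_inf[of 3]] zero_in_U_inf[of 3] 1 by auto
    define t0 where "t0 = (a + s) / 2"
    have t0: "t0 \<in> {0..<s} \<inter> {a<..}" using a by (auto simp: t0_def)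
    have "home (g t0) \<in> T"
      using in_H[of t0] t0 edge_ends by (cases "g t0" rule: H_hat_cases) auto
    then obtain C M where C: "home (g t0) \<in> C" "C \<subseteq> T" "\<not> crossed 3 C" and
      M: "3 \<le> M" "\<And>u. u \<in> C \<Longrightarrow> E_labels w u \<subseteq> {1..<M}"
      using not_crossed_component by metis
    have in_C: "g ` ({0..<s} \<inter> {a<..}) \<subseteq> star 3 C"
      by (rule stay[OF _ a(3) C(3) t0 C(1)]) auto
    \<comment> \<open>Second round: the bound \<open>M\<close> depends on \<open>C\<close>, hence on
      where the lift is, so \<open>f\<close> can be restricted to \<open>U_inf M\<close> only
      now.\<close>
    obtain a' where a': "0 \<le> a'" "a' < s" "\<And>t. t \<in> {0..<s} \<inter> {a'<..} \<Longrightarrow> q_map (g t) \<in> U_inf M"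
      using near[OF openin_U_inf[of M]] zero_in_U_inf[of M] 1 M(1) by auto
    define c where "c = max a a'"
    define t1 where "t1 = (c + s) / 2"
    define v where "v = home (g t1)"
    have c: "0 \<le> c" "c < s" using a a' by (auto simp: c_def)
    then have t1: "t1 \<in> {0..<s} \<inter> {c<..}" by (auto simp: t1_def)
    then have "g t1 \<in> star 3 C" using in_C by (auto simp: c_def)
    then have v: "v \<in> C" by (simp add: star_def v_def)
    have "g ` ({0..<s} \<inter> {c<..}) \<subseteq> star M {v}"
      by (rule stay[OF _ _ not_crossed_singleton[OF M(2)[OF v]] t1])
         (use M(1) a'(3) v_def in \<open>auto simp: c_def\<close>)
    moreover have "openin chart_topology (star M {v})"
      using M not_crossed_singleton v by (intro openin_star) auto
    moreover have "Vertex v \<in> star M {v}" "q_map (Vertex v) = f s"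
      using v C(2) M(1) 1 by (auto simp: Vertex_in_star_iff)
    ultimately show ?thesis
      using inj_on_star c(2) by blast
  qed
qed

end

theorem proposition3p2:
  fixes w :: "nat \<Rightarrow> word" and f :: "real \<Rightarrow> real \<times> real"
  assumes "w ` {1..} = words - {[]}"
    and "pathin (top_of_set hawaiian) f"
    and "f 0 = (0, 0)"
  shows "\<exists>!g. g \<in> extensional {0..1} \<and> pathin (H_hat_topology w) g \<and>
           g 0 = Vertex [] \<and> (\<forall>t\<in>{0..1}. q_map (g t) = f t)"
proof -
  interpret word_list w by unfold_locales (rule assms(1))
  have f: "continuous_map (top_of_set {0..1}) (top_of_set hawaiian) f"
    using assms(2) by (simp add: pathin_def)
  have lift_iff: "pathin (H_hat_topology w) g \<and> g 0 = Vertex [] \<and> (\<forall>t\<in>{0..1}. q_map (g t) = f t) \<longleftrightarrow>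
    lift_on f (Vertex []) {0..1} g" for g
    by (simp add: pathin_def lift_on_def H_hat_topology_eq)
  obtain g where g: "lift_on f (Vertex []) {0..1} g"
  proof (rule lift_exists[OF f])
    show "Vertex [] \<in> topspace chart_topology" "q_map (Vertex []) = f 0"
      using Nil_in_tree_star assms(3) by (simp_all add: Vertex_in_H_hat)
  qed (rule lift_near_end[OF f])
  show ?thesis
    unfolding lift_iff
  proof (rule ex1I)
    \<comment> \<open>Uniqueness is among functions fixed outside the unit interval, so the lift is
      replaced by its restriction, which has the same values on the interval.\<close>
    have "continuous_map (top_of_set {0..1}) chart_topology (restrict g {0..1})"
      by (rule continuous_map_eq[of _ _ g]) (use g in \<open>auto simp: lift_on_def\<close>)
    with g show "restrict g {0..1} \<in> extensional {0..1} \<and> lift_on f (Vertex []) {0..1} (restrict g {0..1})"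
      by (simp add: lift_on_def)
  next
    fix h assume h: "h \<in> extensional {0..1} \<and> lift_on f (Vertex []) {0..1} h"
    have "connected_space (top_of_set {0..1::real})"
      using connectedin_iff_connected[of "{0..1::real}"] by (simp add: connectedin_def)
    then have "h t = g t" if "t \<in> {0..1}" for t
      by (rule lift_unique[where a = 0]) (use g h that in \<open>auto simp: lift_on_def\<close>)
    with h show "h = restrict g {0..1}"
      by (intro extensionalityI[of _ "{0..1}"]) auto
  qed
qed

end
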